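(* Let $k$ be a positive integer, let $\epsilon > 0$, let $G$ be a finite abelian group and let $A_1,\dots,A_k \subseteq G$. Then there is a pair $(R,\eta)$, where $R$ is a set of characters of $G$ with $d = |R| \leq W(2^{11}k^2\epsilon^{-3})$ and $\eta \in (0,1]$ satisfies $\eta \geq 1/W(2^{11}k^2\epsilon^{-3})$, such that $(R,\eta)$ is $\epsilon$-regular for each of $A_1,\dots,A_k$ (with respect to the parameters $k,\epsilon$).
   Context: $G$ is a finite abelian group, $N = |G|$, $G^{\ast}$ is its group of characters $\gamma : G \to \mathbb{C}$. For $f : G \to \mathbb{R}$, $\widehat{f}(\gamma) = \sum_x f(x)\gamma(x)$; convolution is $f \ast g(x) = \sum_y f(y)g(x-y)$. A set is identified with its indicator function. The argument of a nonzero complex number is taken in $(-\pi,\pi]$. For a finite set of characters $\Gamma = \{\gamma_1,\dots,\gamma_d\}$ and $x \in G$ put $\|x\|_{\Gamma} = \max_j |\arg \gamma_j(x)|/(2\pi)$ (and $\|x\|_{\emptyset} = 0$), and for $t \ge 0$ let $B_{\Gamma,t} = \{x : \|x\|_\Gamma \leq t\}$. For $\delta > 0$ define $\widetilde{B}_{\Gamma,\delta}(x) = \int_0^\infty B_{\Gamma,t}(x)\, \delta^{-1}e^{-t/\delta}\,dt$, $\beta_{\Gamma,\delta} = \widetilde{B}_{\Gamma,\delta}/\sum_y \widetilde{B}_{\Gamma,\delta}(y)$, and $\psi_{\Gamma,\delta} = \beta_{\Gamma,\delta} \ast \beta_{\Gamma,\delta}$. Given $k$, $\epsilon$ and a pair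 $(R,\eta)$ with $R \subseteq G^{\ast}$, $d = |R|$, $\eta \in (0,1]$, set $\psi_1 = \psi_{R,\eta}$ and $\psi_2 = \psi_{R,\eta_2}$ with $\eta_2 = 2^{-40}\epsilon^6\eta/(dk^4)$ (if $d = 0$ then $\psi_{\emptyset,\delta} \equiv 1/N$ for every $\delta$, so the value of $\eta_2$ is immaterial). For $A \subseteq G$ and $x \in G$ write $\alpha_j^x = (A \ast \psi_j)(x)$ for $j = 1,2$. A point $x \in G$ is an $\epsilon$-regular value with respect to $A$ and $(R,\eta)$ if (i) $\sum_y (\alpha_2^{x+y} - \alpha_1^x)^2\psi_1(y) \leq \epsilon^2$, and (ii) for every $\gamma \in G^{\ast}$, $\left|\sum_n (A(x+n) - \alpha_2^x)\psi_2(n)\gamma(n)\right| \leq \epsilon$. The pair $(R,\eta)$ is $\epsilon$-regular for $A$ if fewer than $\epsilon N$ elements $x \in G$ fail to be $\epsilon$-regular values with respect to $A$. $W(t)$ denotes a tower of twos of height $\lceil t \rceil$ (i.e. $W(t) = w_{\lceil t\rceil}$ where $w_0 = 1$, $w_{h+1} = 2^{w_h}$). *)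

theory Defs
  imports "HOL-Analysis.Analysis"
begin

definition character :: "('a::ab_group_add \<Rightarrow> complex) \<Rightarrow> bool" where
  "character \<gamma> \<longleftrightarrow> (\<forall>x y. \<gamma> (x + y) = \<gamma> x * \<gamma> y) \<and> (\<forall>x. cmod (\<gamma> x) = 1)"

definition conv :: "('a::{ab_group_add,finite} \<Rightarrow> real) \<Rightarrow> ('a \<Rightarrow> real) \<Rightarrow> 'a \<Rightarrow> real" where
  "conv f g x = (\<Sum>y\<in>UNIV. f y * g (x - y))"

definition bnorm :: "('a \<Rightarrow> complex) set \<Rightarrow> 'a \<Rightarrow> real" where
  "bnorm \<Gamma> x = (if \<Gamma> = {} then 0 else Max ((\<lambda>\<gamma>. \<bar>Arg (\<gamma> x)\<bar> / (2 * pi)) ` \<Gamma>))"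

definition bohr :: "('a \<Rightarrow> complex) set \<Rightarrow> real \<Rightarrow> 'a set" where
  "bohr \<Gamma> t = {x. bnorm \<Gamma> x \<le> t}"

definition smooth_bohr :: "('a \<Rightarrow> complex) set \<Rightarrow> real \<Rightarrow> 'a \<Rightarrow> real" where
  "smooth_bohr \<Gamma> \<delta> x =
     integral {0..} (\<lambda>t. indicator (bohr \<Gamma> t) x * (exp (- t / \<delta>) / \<delta>))"

definition beta_fn :: "('a::{ab_group_add,finite} \<Rightarrow> complex) set \<Rightarrow> real \<Rightarrow> 'a \<Rightarrow> real" where
  "beta_fn \<Gamma> \<delta> x = smooth_bohr \<Gamma> \<delta> x / (\<Sum>y\<in>UNIV. smooth_bohr \<Gamma> \<delta> y)"

definition psi_fn :: "('a::{ab_group_add,finite} \<Rightarrow> complex) set \<Rightarrow> real \<Rightarrow> 'a \<Rightarrow> real" where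
  "psi_fn \<Gamma> \<delta> = conv (beta_fn \<Gamma> \<delta>) (beta_fn \<Gamma> \<delta>)"

text \<open>The second scale; when d = 0 its value is immaterial, we take 1.\<close>
definition eta2 :: "nat \<Rightarrow> real \<Rightarrow> ('a \<Rightarrow> complex) set \<Rightarrow> real \<Rightarrow> real" where
  "eta2 k \<epsilon> R \<eta> = (if card R = 0 then 1
      else 2 powr (-40) * \<epsilon> ^ 6 * \<eta> / (real (card R) * real k ^ 4))"

definition psi1 :: "('a::{ab_group_add,finite} \<Rightarrow> complex) set \<Rightarrow> real \<Rightarrow> 'a \<Rightarrow> real" where
  "psi1 R \<eta> = psi_fn R \<eta>"

definition psi2 :: "nat \<Rightarrow> real \<Rightarrow> ('a::{ab_group_add,finite} \<Rightarrow> complex) set \<Rightarrow> real \<Rightarrow> 'a \<Rightarrow> real" where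
  "psi2 k \<epsilon> R \<eta> = psi_fn R (eta2 k \<epsilon> R \<eta>)"

definition regular_value ::
  "nat \<Rightarrow> real \<Rightarrow> 'a::{ab_group_add,finite} set \<Rightarrow> ('a \<Rightarrow> complex) set \<Rightarrow> real \<Rightarrow> 'a \<Rightarrow> bool" where
  "regular_value k \<epsilon> A R \<eta> x \<longleftrightarrow>
     (let p1 = psi1 R \<eta>; p2 = psi2 k \<epsilon> R \<eta>;
          a1 = conv (indicator A) p1; a2 = conv (indicator A) p2 in
      (\<Sum>y\<in>UNIV. (a2 (x + y) - a1 x)^2 * p1 y) \<le> \<epsilon>^2 \<and>
      (\<forall>\<gamma>. character \<gamma> \<longrightarrow>
         cmod (\<Sum>n\<in>UNIV. complex_of_real ((indicator A (x + n) - a2 x) * p2 n) * \<gamma> n) \<le> \<epsilon>))"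

definition regular_pair ::
  "nat \<Rightarrow> real \<Rightarrow> 'a::{ab_group_add,finite} set \<Rightarrow> ('a \<Rightarrow> complex) set \<Rightarrow> real \<Rightarrow> bool" where
  "regular_pair k \<epsilon> A R \<eta> \<longleftrightarrow>
     real (card {x. \<not> regular_value k \<epsilon> A R \<eta> x}) < \<epsilon> * real CARD('a)"

fun tower :: "nat \<Rightarrow> nat" where
  "tower 0 = 1"
| "tower (Suc h) = 2 ^ tower h"

definition W :: "real \<Rightarrow> nat" where
  "W t = tower (nat \<lceil>t\<rceil>)"

end

(*
  The total energy of a pair (R, eta) is the sum over j of the mean square of A_j * psi_{R, eta}; it
  lies between 0 and k N. If A_i fails regularity condition (i) at many points, then replacing eta by
  eta_2 raises the energy, because the local variance of alpha_2 about alpha_1, summed over x, is up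
  to a small error the difference of the two energies. If (ii) fails at many points, adjoin to R
  every character that has a large local Fourier coefficient somewhere and shrink eta until these
  characters are nearly constant at the new scale: the large coefficients are then visible in the
  new densities, and again a local variance is large. Both steps gain at least epsilon^3 N / 16, so
  there are at most 16 k / epsilon^3 of them, and each one costs two exponentials in the bounds for
  |R| and 1 / eta.
*)
theory Submission
  imports Defs
begin

section \<open>Characters and Bohr sets\<close>

text \<open>Exponential smoothing turns the Bohr set into exp (- ||x|| / \<delta>), so translating
  the kernel by y costs a factor of at most exp (||y|| / \<delta>). The resulting L1 translation
  bound is linear in ||y|| at every scale, and no regular radii have to be selected. What then
  matters is the mean of ||y|| under the finer kernel. Doubling makes it O(d \<delta>), which is why
  |R| stands in the denominators of the new scales. One obstacle is that energy is only almost
  monotone under refinement: one set is known to gain, but all k sets may lose. The loss allowed to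
  each set therefore carries a factor 1/k. The other is that the bad points may form a positive
  proportion of G, each with its own character, while the number of adjoined characters must not
  depend on N. Local coefficients vary slowly with x, so one large value contributes a whole Bohr
  set of large values to Bessel's inequality. The resulting count is exponential in |R|.\<close>

lemma character_zero:
  assumes "character \<gamma>" shows "\<gamma> 0 = 1"
proof -
  have "\<gamma> 0 * \<gamma> 0 = \<gamma> 0" using assms unfolding character_def by (metis add_0)
  moreover have "\<gamma> 0 \<noteq> 0" using assms unfolding character_def by (metis norm_zero zero_neq_one)
  ultimately show ?thesis by simp
qed

lemma character_add: "character \<gamma> \<Longrightarrow> \<gamma> (x + y) = \<gamma> x * \<gamma> y"
  and character_norm: "character \<gamma> \<Longrightarrow> cmod (\<gamma> x) = 1"
  unfolding character_def by auto

lemma character_minus: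
  assumes "character \<gamma>" shows "\<gamma> (- x) = cnj (\<gamma> x)"
proof -
  have "\<gamma> x * \<gamma> (- x) = 1"
    using character_add[OF assms, of x "- x"] character_zero[OF assms] by simp
  moreover have "\<gamma> x * cnj (\<gamma> x) = 1"
    by (simp add: complex_norm_square[symmetric] character_norm[OF assms])
  ultimately show ?thesis by (metis mult.commute mult.left_commute mult.right_neutral)
qed

lemma character_cis:
  assumes "character \<gamma>" shows "\<gamma> x = cis (Arg (\<gamma> x))"
proof -
  have "\<gamma> x \<noteq> 0" using character_norm[OF assms, of x] by auto
  then show ?thesis by (simp add: cis_Arg sgn_eq character_norm[OF assms])
qed

text \<open>The principal argument has the least absolute value among all arguments. This is the
  source of the triangle inequality for \<open>bnorm\<close>.\<close>

lemma abs_Arg_cis_le: "\<bar>Arg (cis t)\<bar> \<le> \<bar>t\<bar>"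
proof (cases "t \<in> {- pi<..pi}")
  case True then show ?thesis by (simp add: Arg_cis)
next
  case False
  then have "pi \<le> \<bar>t\<bar>" by auto
  then show ?thesis using Arg_bounded[of "cis t"] by auto
qed

lemma abs_Arg_character_add:
  assumes "character \<gamma>"
  shows "\<bar>Arg (\<gamma> (x + y))\<bar> \<le> \<bar>Arg (\<gamma> x)\<bar> + \<bar>Arg (\<gamma> y)\<bar>"
proof -
  have "\<gamma> (x + y) = cis (Arg (\<gamma> x)) * cis (Arg (\<gamma> y))"
    using character_add[OF assms] character_cis[OF assms] by metis
  then have "\<gamma> (x + y) = cis (Arg (\<gamma> x) + Arg (\<gamma> y))" by (simp add: cis_mult)
  then show ?thesis using abs_Arg_cis_le[of "Arg (\<gamma> x) + Arg (\<gamma> y)"] by simp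
qed

lemma abs_Arg_character_minus:
  assumes "character \<gamma>" shows "\<bar>Arg (\<gamma> (- x))\<bar> = \<bar>Arg (\<gamma> x)\<bar>"
  by (simp add: character_minus[OF assms] Arg_cnj)

text \<open>The right side keeps the signs: two points whose arguments are close but both large must
  have a small difference, which subadditivity alone would not give. The covering argument needs
  this form.\<close>

lemma abs_Arg_character_diff:
  assumes "character \<gamma>"
  shows "\<bar>Arg (\<gamma> (x - y))\<bar> \<le> \<bar>Arg (\<gamma> x) - Arg (\<gamma> y)\<bar>"
proof -
  have "\<gamma> (x - y) = \<gamma> x * cnj (\<gamma> y)"
    using character_add[OF assms, of x "- y"] character_minus[OF assms] by simp
  also have "\<dots> = cis (Arg (\<gamma> x)) * cnj (cis (Arg (\<gamma> y)))"
    using character_cis[OF assms] by metis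
  also have "\<dots> = cis (Arg (\<gamma> x) - Arg (\<gamma> y))"
    by (simp add: cis_cnj cis_mult)
  finally show ?thesis using abs_Arg_cis_le by metis
qed

text \<open>A chord is no longer than its arc. This makes a character of small argument nearly
  constant under translation.\<close>

lemma cmod_character_minus_one_le:
  assumes "character \<gamma>" shows "cmod (\<gamma> x - 1) \<le> \<bar>Arg (\<gamma> x)\<bar>"
proof -
  let ?t = "Arg (\<gamma> x)"
  have "(cmod (cis ?t - 1))\<^sup>2 = (cos ?t - 1)\<^sup>2 + (sin ?t)\<^sup>2"
    by (simp add: cmod_power2)
  also have "\<dots> = 2 - 2 * cos ?t"
    using sin_cos_squared_add[of ?t] by (simp add: power2_eq_square algebra_simps)
  also have "\<dots> = (2 * sin (?t / 2))\<^sup>2"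
    using cos_double_sin[of "?t / 2"] by (simp add: power2_eq_square)
  finally have "(cmod (cis ?t - 1))\<^sup>2 = \<bar>2 * sin (?t / 2)\<bar>\<^sup>2" by (simp only: power2_abs)
  then have "cmod (cis ?t - 1) = \<bar>2 * sin (?t / 2)\<bar>"
    by (rule power2_eq_imp_eq) (rule norm_ge_zero abs_ge_zero)+
  also have "\<dots> \<le> \<bar>?t\<bar>" using abs_sin_x_le_abs_x[of "?t / 2"] by simp
  finally show ?thesis using character_cis[OF assms, of x] by metis
qed

lemma bnorm_nonneg:
  assumes "finite \<Gamma>" shows "0 \<le> bnorm \<Gamma> x"
proof (cases "\<Gamma> = {}")
  case False
  then obtain \<gamma> where "\<gamma> \<in> \<Gamma>" by auto
  then have "\<bar>Arg (\<gamma> x)\<bar> / (2 * pi) \<le> bnorm \<Gamma> x"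
    using assms False unfolding bnorm_def by (auto intro!: Max_ge)
  then show ?thesis by (meson abs_ge_zero divide_nonneg_pos dual_order.trans mult_pos_pos pi_gt_zero zero_less_numeral)
qed (simp add: bnorm_def)

lemma Arg_le_bnorm:
  assumes "finite \<Gamma>" "\<gamma> \<in> \<Gamma>" shows "\<bar>Arg (\<gamma> x)\<bar> \<le> 2 * pi * bnorm \<Gamma> x"
proof -
  have "\<bar>Arg (\<gamma> x)\<bar> / (2 * pi) \<le> bnorm \<Gamma> x"
    using assms unfolding bnorm_def by (auto intro!: Max_ge)
  then show ?thesis by (simp add: field_simps)
qed

lemma bnorm_leI:
  assumes "finite \<Gamma>" "0 \<le> r" "\<And>\<gamma>. \<gamma> \<in> \<Gamma> \<Longrightarrow> \<bar>Arg (\<gamma> x)\<bar> \<le> 2 * pi * r"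
  shows "bnorm \<Gamma> x \<le> r"
  using assms by (auto simp: bnorm_def field_simps)

lemma bnorm_le_half:
  assumes "finite \<Gamma>" shows "bnorm \<Gamma> x \<le> 1 / 2"
proof (rule bnorm_leI[OF assms])
  show "\<bar>Arg (\<gamma> x)\<bar> \<le> 2 * pi * (1 / 2)" for \<gamma> using Arg_bounded[of "\<gamma> x"] by auto
qed simp

lemma bnorm_triangle:
  assumes "finite \<Gamma>" "\<Gamma> \<subseteq> {\<gamma>. character \<gamma>}"
  shows "bnorm \<Gamma> (x + y) \<le> bnorm \<Gamma> x + bnorm \<Gamma> y"
proof (rule bnorm_leI[OF assms(1)])
  show "0 \<le> bnorm \<Gamma> x + bnorm \<Gamma> y" by (simp add: bnorm_nonneg assms)
  fix \<gamma> assume g: "\<gamma> \<in> \<Gamma>"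
  have "\<bar>Arg (\<gamma> (x + y))\<bar> \<le> \<bar>Arg (\<gamma> x)\<bar> + \<bar>Arg (\<gamma> y)\<bar>"
    using abs_Arg_character_add g assms(2) by auto
  also have "\<dots> \<le> 2 * pi * (bnorm \<Gamma> x + bnorm \<Gamma> y)"
    using Arg_le_bnorm[OF assms(1) g, of x] Arg_le_bnorm[OF assms(1) g, of y]
    by (simp add: algebra_simps)
  finally show "\<bar>Arg (\<gamma> (x + y))\<bar> \<le> 2 * pi * (bnorm \<Gamma> x + bnorm \<Gamma> y)" .
qed

lemma bnorm_minus:
  assumes "\<Gamma> \<subseteq> {\<gamma>. character \<gamma>}" shows "bnorm \<Gamma> (- x) = bnorm \<Gamma> x"
proof -
  have "(\<lambda>\<gamma>. \<bar>Arg (\<gamma> (- x))\<bar> / (2 * pi)) ` \<Gamma> = (\<lambda>\<gamma>. \<bar>Arg (\<gamma> x)\<bar> / (2 * pi)) ` \<Gamma>"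
    using assms abs_Arg_character_minus by (intro image_cong) auto
  then show ?thesis by (simp add: bnorm_def)
qed

lemma bnorm_mono:
  assumes "finite \<Gamma>'" "\<Gamma> \<subseteq> \<Gamma>'" shows "bnorm \<Gamma> x \<le> bnorm \<Gamma>' x"
  using assms by (intro bnorm_leI Arg_le_bnorm bnorm_nonneg) (auto intro: finite_subset)

section \<open>Layer-cake integrals, covering and doubling of Bohr sets\<close>

text \<open>The indicator switches on at t = \<open>bnorm \<Gamma> x / c\<close>, which leaves an
  exponential tail. The dilation c under a fixed weight allows scales \<delta> and 2\<delta> to be
  compared under one integral, pointwise in t.\<close>

lemma has_integral_bohr:
  assumes "finite \<Gamma>" "\<delta> > 0" "c > 0"
  shows "((\<lambda>t. indicator (bohr \<Gamma> (c * t)) x * (exp (- t / \<delta>) / \<delta>)) has_integral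
           exp (- bnorm \<Gamma> x / (c * \<delta>))) {0..}"
proof -
  let ?a = "bnorm \<Gamma> x / c"
  have a: "?a \<ge> 0" using bnorm_nonneg[OF assms(1)] assms(3) by simp
  have "((\<lambda>t. exp (- (1 / \<delta>) * t)) has_integral exp (- (1 / \<delta>) * ?a) / (1 / \<delta>)) {?a..}"
    using assms by (intro has_integral_exp_minus_to_infinity) simp
  from has_integral_mult_left[OF this, of "1 / \<delta>"]
  have "((\<lambda>t. exp (- t / \<delta>) / \<delta>) has_integral exp (- bnorm \<Gamma> x / (c * \<delta>))) {?a..}"
    using assms by (simp add: field_simps)
  then have "((\<lambda>t. if t \<in> {?a..} then exp (- t / \<delta>) / \<delta> else 0) has_integral
      exp (- bnorm \<Gamma> x / (c * \<delta>))) {0..}"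
    using a by (subst has_integral_restrict) auto
  moreover have "(if t \<in> {?a..} then exp (- t / \<delta>) / \<delta> else 0) =
      indicator (bohr \<Gamma> (c * t)) x * (exp (- t / \<delta>) / \<delta>)" for t
    using assms(3) by (auto simp: bohr_def indicator_def field_simps)
  ultimately show ?thesis by simp
qed

text \<open>All kernel estimates go through this closed form: the triangle inequality in the
  exponent becomes a multiplicative bound.\<close>

lemma smooth_bohr_eq_exp:
  assumes "finite \<Gamma>" "\<delta> > 0"
  shows "smooth_bohr \<Gamma> \<delta> x = exp (- bnorm \<Gamma> x / \<delta>)"
  unfolding smooth_bohr_def
  using has_integral_bohr[OF assms, of 1 x] by (intro integral_unique) simp

lemma card_int_Icc_floor_le:
  fixes a :: real
  assumes "a \<ge> 0" shows "real (card {\<lfloor>- a\<rfloor>..\<lfloor>a\<rfloor>}) \<le> 2 * a + 2"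
proof -
  have "\<lfloor>- a\<rfloor> \<le> \<lfloor>a\<rfloor>" using assms by (intro floor_mono) auto
  then have "real (card {\<lfloor>- a\<rfloor>..\<lfloor>a\<rfloor>}) = of_int \<lfloor>a\<rfloor> - of_int \<lfloor>- a\<rfloor> + 1" by simp
  then show ?thesis by linarith
qed

text \<open>Cut the box \<open>[-r, r]\<close> of the torus into cells of side \<open>t\<close>: the points of a cell lie in
  one translate of \<open>bohr \<Gamma> t\<close>.\<close>

lemma card_bohr_le:
  fixes \<Gamma> :: "('a::{ab_group_add,finite} \<Rightarrow> complex) set"
  assumes "finite \<Gamma>" "\<Gamma> \<subseteq> {\<gamma>. character \<gamma>}" "t > 0" "r \<ge> 0"
  shows "real (card (bohr \<Gamma> r)) \<le> (2 * r / t + 2) ^ card \<Gamma> * real (card (bohr \<Gamma> t))"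
proof -
  define cell where "cell x = (\<lambda>\<gamma>\<in>\<Gamma>. \<lfloor>Arg (\<gamma> x) / (2 * pi * t)\<rfloor>)" for x
  define I where "I = {\<lfloor>- (r / t)\<rfloor>..\<lfloor>r / t\<rfloor>}"
  have sub: "cell ` bohr \<Gamma> r \<subseteq> (\<Pi>\<^sub>E \<gamma>\<in>\<Gamma>. I)"
  proof (clarify, intro PiE_I)
    fix x \<gamma> assume x: "x \<in> bohr \<Gamma> r" and g: "\<gamma> \<in> \<Gamma>"
    have "\<bar>Arg (\<gamma> x)\<bar> \<le> 2 * pi * bnorm \<Gamma> x" by (rule Arg_le_bnorm[OF assms(1) g])
    also have "\<dots> \<le> 2 * pi * r" using x by (simp add: bohr_def)
    finally have "- (r / t) \<le> Arg (\<gamma> x) / (2 * pi * t) \<and> Arg (\<gamma> x) / (2 * pi * t) \<le> r / t"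
      using assms(3) by (simp add: field_simps abs_le_iff)
    then show "cell x \<gamma> \<in> I" unfolding I_def cell_def using g by (auto intro: floor_mono)
  qed (simp add: cell_def)
  have fib: "card {x \<in> bohr \<Gamma> r. cell x = c} \<le> card (bohr \<Gamma> t)" for c
  proof (cases "{x \<in> bohr \<Gamma> r. cell x = c} = {}")
    case False
    then obtain z where z: "cell z = c" by auto
    have "(\<lambda>x. x - z) ` {x \<in> bohr \<Gamma> r. cell x = c} \<subseteq> bohr \<Gamma> t"
    proof clarify
      fix x assume "c = cell x"
      with z have eq: "cell x = cell z" by simp
      show "x - z \<in> bohr \<Gamma> t" unfolding bohr_def
      proof (rule CollectI, rule bnorm_leI[OF assms(1)])
        fix \<gamma> assume g: "\<gamma> \<in> \<Gamma>"
        have "\<lfloor>Arg (\<gamma> x) / (2 * pi * t)\<rfloor> = \<lfloor>Arg (\<gamma> z) / (2 * pi * t)\<rfloor>"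
          using fun_cong[OF eq, of \<gamma>] g by (simp add: cell_def)
        then have "\<bar>Arg (\<gamma> x) / (2 * pi * t) - Arg (\<gamma> z) / (2 * pi * t)\<bar> \<le> 1" by linarith
        then have "\<bar>Arg (\<gamma> x) - Arg (\<gamma> z)\<bar> / (2 * pi * t) \<le> 1"
          using assms(3) unfolding diff_divide_distrib[symmetric] by (simp add: abs_mult)
        then have "\<bar>Arg (\<gamma> x) - Arg (\<gamma> z)\<bar> \<le> 2 * pi * t"
          using assms(3) by (simp add: pos_divide_le_eq)
        then show "\<bar>Arg (\<gamma> (x - z))\<bar> \<le> 2 * pi * t"
          using abs_Arg_character_diff[of \<gamma> x z] assms(2) g by auto
      qed (use assms in simp)
    qed
    then show ?thesis by (intro card_inj_on_le[of "\<lambda>x. x - z"]) (auto simp: inj_on_def)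
  next
    case True then show ?thesis by (simp only: card.empty zero_le)
  qed
  have "bohr \<Gamma> r = (\<Union>c\<in>cell ` bohr \<Gamma> r. {x \<in> bohr \<Gamma> r. cell x = c})" by auto
  then have "card (bohr \<Gamma> r) \<le> (\<Sum>c\<in>cell ` bohr \<Gamma> r. card {x \<in> bohr \<Gamma> r. cell x = c})"
    using card_UN_le[of "cell ` bohr \<Gamma> r" "\<lambda>c. {x \<in> bohr \<Gamma> r. cell x = c}"] by simp
  also have "\<dots> \<le> card (cell ` bohr \<Gamma> r) * card (bohr \<Gamma> t)"
    using sum_bounded_above[OF fib] by simp
  also have "card (cell ` bohr \<Gamma> r) \<le> card I ^ card \<Gamma>"
    using card_mono[OF finite_PiE sub] assms(1) by (simp add: card_PiE I_def)
  finally have "card (bohr \<Gamma> r) \<le> card I ^ card \<Gamma> * card (bohr \<Gamma> t)" by simp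
  then have "real (card (bohr \<Gamma> r)) \<le> real (card I) ^ card \<Gamma> * real (card (bohr \<Gamma> t))"
    by (metis of_nat_le_iff of_nat_mult of_nat_power)
  also have "\<dots> \<le> (2 * r / t + 2) ^ card \<Gamma> * real (card (bohr \<Gamma> t))"
    using card_int_Icc_floor_le[of "r / t"] assms unfolding I_def
    by (intro mult_right_mono power_mono) auto
  finally show ?thesis .
qed

text \<open>Every point has norm at most 1/2, so covering with r = 1/2 covers the group. This bounds
  the density of a Bohr set from below independently of N.\<close>

lemma card_UNIV_le_bohr:
  fixes \<Gamma> :: "('a::{ab_group_add,finite} \<Rightarrow> complex) set"
  assumes "finite \<Gamma>" "\<Gamma> \<subseteq> {\<gamma>. character \<gamma>}" "t > 0"
  shows "real CARD('a) \<le> (1 / t + 2) ^ card \<Gamma> * real (card (bohr \<Gamma> t))"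
proof -
  have "bohr \<Gamma> (1 / 2) = (UNIV :: 'a set)" unfolding bohr_def using bnorm_le_half[OF assms(1)] by auto
  then show ?thesis using card_bohr_le[OF assms, of "1 / 2"] by simp
qed

text \<open>The 6 is the covering constant 2r/t + 2 at r = 2t. Both sides are integrals of Bohr set
  sizes against the same weight.\<close>

lemma sum_smooth_bohr_doubling:
  fixes \<Gamma> :: "('a::{ab_group_add,finite} \<Rightarrow> complex) set"
  assumes "finite \<Gamma>" "\<Gamma> \<subseteq> {\<gamma>. character \<gamma>}" "\<delta> > 0"
  shows "(\<Sum>x\<in>UNIV. exp (- bnorm \<Gamma> x / (2 * \<delta>))) \<le> 6 ^ card \<Gamma> * (\<Sum>x\<in>UNIV. exp (- bnorm \<Gamma> x / \<delta>))"
proof -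
  let ?w = "\<lambda>t. exp (- t / \<delta>) / \<delta>"
  have layer: "((\<lambda>t. real (card (bohr \<Gamma> (c * t))) * ?w t) has_integral
      (\<Sum>x\<in>UNIV. exp (- bnorm \<Gamma> x / (c * \<delta>)))) {0..}" if "c > 0" for c
  proof -
    have "((\<lambda>t. \<Sum>x\<in>UNIV. indicator (bohr \<Gamma> (c * t)) x * ?w t) has_integral
        (\<Sum>x\<in>UNIV. exp (- bnorm \<Gamma> x / (c * \<delta>)))) {0..}"
      by (intro has_integral_sum has_integral_bohr assms that) simp
    moreover have "(\<Sum>x\<in>UNIV. indicator (bohr \<Gamma> (c * t)) x * ?w t) = real (card (bohr \<Gamma> (c * t))) * ?w t" for t
    proof -
      have "(\<Sum>x\<in>UNIV. indicat_real (bohr \<Gamma> (c * t)) x) = real (card (bohr \<Gamma> (c * t)))"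
        by (simp add: indicator_def)
      then show ?thesis by (simp only: sum_distrib_right[symmetric])
    qed
    ultimately show ?thesis by simp
  qed
  show ?thesis
  proof (rule has_integral_le)
    show "((\<lambda>t. real (card (bohr \<Gamma> (2 * t))) * ?w t) has_integral
      (\<Sum>x\<in>UNIV. exp (- bnorm \<Gamma> x / (2 * \<delta>)))) {0..}" by (rule layer) simp
    show "((\<lambda>t. 6 ^ card \<Gamma> * (real (card (bohr \<Gamma> t)) * ?w t)) has_integral
      6 ^ card \<Gamma> * (\<Sum>x\<in>UNIV. exp (- bnorm \<Gamma> x / \<delta>))) {0..}"
      using has_integral_mult_right[OF layer[of 1], of "6 ^ card \<Gamma>"] by simp
    fix t :: real assume "t \<in> {0..}"
    \<comment> \<open>The covering bound requires a positive cell side; at t = 0 the two Bohr sets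
      coincide.\<close>
    then consider "t = 0" | "t > 0" by force
    then have "real (card (bohr \<Gamma> (2 * t))) \<le> 6 ^ card \<Gamma> * real (card (bohr \<Gamma> t))"
    proof cases
      case 1
      have "(1::real) * real (card (bohr \<Gamma> 0)) \<le> 6 ^ card \<Gamma> * real (card (bohr \<Gamma> 0))"
        by (intro mult_right_mono) auto
      with 1 show ?thesis by simp
    next
      case 2
      then show ?thesis using card_bohr_le[OF assms(1,2), of t "2 * t"] by simp
    qed
    then show "real (card (bohr \<Gamma> (2 * t))) * ?w t \<le> 6 ^ card \<Gamma> * (real (card (bohr \<Gamma> t)) * ?w t)"
      unfolding mult.assoc[symmetric] using assms(3) by (intro mult_right_mono) auto
  qed
qed

section \<open>The kernels \<open>\<beta>\<close> and \<open>\<psi>\<close>\<close>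

lemma sum_group_add_shift:
  fixes f :: "'a::{ab_group_add,finite} \<Rightarrow> 'b::comm_monoid_add"
  shows "(\<Sum>x\<in>UNIV. f (x + y)) = (\<Sum>x\<in>UNIV. f x)"
    and "(\<Sum>x\<in>UNIV. f (y + x)) = (\<Sum>x\<in>UNIV. f x)"
    and "(\<Sum>x\<in>UNIV. f (x - y)) = (\<Sum>x\<in>UNIV. f x)"
    and "(\<Sum>x\<in>UNIV. f (y - x)) = (\<Sum>x\<in>UNIV. f x)"
    and "(\<Sum>x\<in>UNIV. f (- x)) = (\<Sum>x\<in>UNIV. f x)"
  by ((rule sum.reindex_bij_witness[of _ "\<lambda>x. x - y" "\<lambda>x. x + y"]; simp),
      (rule sum.reindex_bij_witness[of _ "\<lambda>x. x - y" "\<lambda>x. y + x"]; simp),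
      (rule sum.reindex_bij_witness[of _ "\<lambda>x. x + y" "\<lambda>x. x - y"]; simp),
      (rule sum.reindex_bij_witness[of _ "\<lambda>x. y - x" "\<lambda>x. y - x"]; simp),
      (rule sum.reindex_bij_witness[of _ uminus uminus]; simp))

text \<open>What the energy comparison uses about a kernel, apart from its translation error.
  Symmetry turns the sums over x + y in the regularity conditions into convolutions.\<close>

definition sym_prob :: "('a::{ab_group_add,finite} \<Rightarrow> real) \<Rightarrow> bool" where
  "sym_prob p \<longleftrightarrow> (\<forall>x. 0 \<le> p x) \<and> (\<forall>x. p (- x) = p x) \<and> (\<Sum>x\<in>UNIV. p x) = 1"

lemma sym_probD:
  assumes "sym_prob p"
  shows "0 \<le> p x" "p (- x) = p x" "(\<Sum>x\<in>UNIV. p x) = 1"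
  using assms unfolding sym_prob_def by auto

lemma sym_prob_conv:
  assumes p: "sym_prob p" and q: "sym_prob q" shows "sym_prob (conv p q)"
proof -
  have "conv p q (- x) = conv p q x" for x
  proof -
    have "conv p q (- x) = (\<Sum>y\<in>UNIV. p (- y) * q (- x - (- y)))"
      unfolding conv_def by (rule sum_group_add_shift(5)[symmetric])
    also have "\<dots> = conv p q x"
      unfolding conv_def
    proof (intro sum.cong refl arg_cong2[where f = "(*)"] sym_probD[OF p])
      show "q (- x - - y) = q (x - y)" for y
        using sym_probD(2)[OF q, of "x - y"] by (simp add: algebra_simps)
    qed
    finally show ?thesis .
  qed
  moreover have "(\<Sum>x\<in>UNIV. conv p q x) = 1"
  proof -
    have "(\<Sum>x\<in>UNIV. conv p q x) = (\<Sum>y\<in>UNIV. p y * (\<Sum>x\<in>UNIV. q (x - y)))"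
      unfolding conv_def sum_distrib_left by (rule sum.swap)
    then show ?thesis by (simp add: sum_group_add_shift sym_probD[OF q] sym_probD[OF p])
  qed
  moreover have "0 \<le> conv p q x" for x
    unfolding conv_def by (intro sum_nonneg mult_nonneg_nonneg sym_probD(1)[OF p] sym_probD(1)[OF q])
  ultimately show ?thesis by (simp add: sym_prob_def)
qed

context
  fixes \<Gamma> :: "('a::{ab_group_add,finite} \<Rightarrow> complex) set" and \<delta> :: real
  assumes fin: "finite \<Gamma>" and chars: "\<Gamma> \<subseteq> {\<gamma>. character \<gamma>}" and pos: "\<delta> > 0"
begin

lemma beta_fn_eq: "beta_fn \<Gamma> \<delta> x = exp (- bnorm \<Gamma> x / \<delta>) / (\<Sum>y\<in>UNIV. exp (- bnorm \<Gamma> y / \<delta>))"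
  using smooth_bohr_eq_exp[OF fin pos] by (simp add: beta_fn_def cong: sum.cong)

lemma sum_exp_bnorm_pos: "(\<Sum>y\<in>UNIV. exp (- bnorm \<Gamma> (y::'a) / \<delta>)) > 0"
  by (intro sum_pos) auto

lemma sym_prob_beta: "sym_prob (beta_fn \<Gamma> \<delta>)"
  unfolding sym_prob_def
proof (intro conjI allI)
  show "0 \<le> beta_fn \<Gamma> \<delta> x" for x
    unfolding beta_fn_eq using sum_exp_bnorm_pos by (intro divide_nonneg_nonneg) auto
  show "beta_fn \<Gamma> \<delta> (- x) = beta_fn \<Gamma> \<delta> x" for x
    unfolding beta_fn_eq by (simp add: bnorm_minus[OF chars])
  show "(\<Sum>x\<in>UNIV. beta_fn \<Gamma> \<delta> x) = 1"
    unfolding beta_fn_eq sum_divide_distrib[symmetric] using sum_exp_bnorm_pos by simp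
qed

lemma beta_fn_shift: "beta_fn \<Gamma> \<delta> x \<le> exp (bnorm \<Gamma> y / \<delta>) * beta_fn \<Gamma> \<delta> (x + y)"
proof -
  have "bnorm \<Gamma> (x + y) \<le> bnorm \<Gamma> x + bnorm \<Gamma> y" by (rule bnorm_triangle[OF fin chars])
  then have "- bnorm \<Gamma> x / \<delta> \<le> bnorm \<Gamma> y / \<delta> + - bnorm \<Gamma> (x + y) / \<delta>"
    using pos by (simp add: field_simps)
  then have "exp (- bnorm \<Gamma> x / \<delta>) \<le> exp (bnorm \<Gamma> y / \<delta>) * exp (- bnorm \<Gamma> (x + y) / \<delta>)"
    by (simp only: exp_add[symmetric] exp_le_cancel_iff)
  then show ?thesis
    unfolding beta_fn_eq using sum_exp_bnorm_pos
    by (simp only: times_divide_eq_right) (rule divide_right_mono[OF _ less_imp_le])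
qed

text \<open>Jensen's inequality for \<open>exp\<close>, applied to the ratio of the two normalising sums.\<close>

lemma beta_fn_mean_bnorm: "(\<Sum>x\<in>UNIV. beta_fn \<Gamma> \<delta> x * bnorm \<Gamma> x) \<le> 4 * card \<Gamma> * \<delta>"
proof -
  let ?L = "real (card \<Gamma>) * ln 6"
  let ?S = "\<Sum>y\<in>UNIV. exp (- bnorm \<Gamma> (y::'a) / \<delta>)"
  have "(\<Sum>x\<in>UNIV. beta_fn \<Gamma> \<delta> x * exp (bnorm \<Gamma> x / (2 * \<delta>))) =
      (\<Sum>x\<in>UNIV. exp (- bnorm \<Gamma> (x::'a) / (2 * \<delta>))) / ?S"
    unfolding sum_divide_distrib
  proof (intro sum.cong refl)
    fix x :: 'a
    have "exp (- bnorm \<Gamma> x / \<delta>) * exp (bnorm \<Gamma> x / (2 * \<delta>)) = exp (- bnorm \<Gamma> x / (2 * \<delta>))"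
      using pos by (simp add: exp_add[symmetric] field_simps)
    then show "beta_fn \<Gamma> \<delta> x * exp (bnorm \<Gamma> x / (2 * \<delta>)) = exp (- bnorm \<Gamma> x / (2 * \<delta>)) / ?S"
      unfolding beta_fn_eq by simp
  qed
  also have "\<dots> \<le> 6 ^ card \<Gamma>"
    using sum_smooth_bohr_doubling[OF fin chars pos] sum_exp_bnorm_pos by (simp add: pos_divide_le_eq)
  also have "\<dots> = exp ?L" by (simp add: exp_of_nat_mult)
  finally have E: "(\<Sum>x\<in>UNIV. beta_fn \<Gamma> \<delta> x * exp (bnorm \<Gamma> x / (2 * \<delta>))) \<le> exp ?L" .
  \<comment> \<open>Jensen in tangent-line form: exp u \<ge> 1 + u with u centred at
    \<open>?L\<close>, the logarithm of the doubling bound, so that the right side becomes at most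
    1.\<close>
  have "(\<Sum>x\<in>UNIV. beta_fn \<Gamma> \<delta> x * (1 + (bnorm \<Gamma> x / (2 * \<delta>) - ?L))) \<le>
      (\<Sum>x\<in>UNIV. beta_fn \<Gamma> \<delta> x * exp (bnorm \<Gamma> x / (2 * \<delta>) - ?L))"
    by (intro sum_mono mult_left_mono exp_ge_add_one_self sym_probD(1)[OF sym_prob_beta])
  also have "\<dots> = (\<Sum>x\<in>UNIV. beta_fn \<Gamma> \<delta> x * exp (bnorm \<Gamma> x / (2 * \<delta>))) / exp ?L"
    by (simp add: exp_diff sum_divide_distrib)
  also have "\<dots> \<le> 1" using E by simp
  also have "(\<Sum>x\<in>UNIV. beta_fn \<Gamma> \<delta> x * (1 + (bnorm \<Gamma> x / (2 * \<delta>) - ?L))) =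
      (1 - ?L) * (\<Sum>x\<in>UNIV. beta_fn \<Gamma> \<delta> x) + (\<Sum>x\<in>UNIV. beta_fn \<Gamma> \<delta> x * bnorm \<Gamma> x) / (2 * \<delta>)"
    unfolding sum_distrib_left sum_divide_distrib sum.distrib[symmetric]
    by (intro sum.cong refl) (simp add: algebra_simps)
  finally have "(\<Sum>x\<in>UNIV. beta_fn \<Gamma> \<delta> x * bnorm \<Gamma> x) / (2 * \<delta>) \<le> ?L"
    by (simp add: sym_probD(3)[OF sym_prob_beta])
  \<comment> \<open>ln 6 \<le> 2 because e \<ge> 5/2 and 25/4 \<ge> 6; clearing the factor
    1/(2\<delta>) then gives the constant 4.\<close>
  also have "\<dots> \<le> real (card \<Gamma>) * 2"
  proof -
    have "5 / 2 \<le> exp (1::real)" using exp_lower_Taylor_quadratic[of 1] by simp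
    then have "5 / 2 * (5 / 2) \<le> exp 1 * exp (1::real)" by (intro mult_mono) auto
    then have "(6::real) \<le> exp 2" by (simp add: exp_add[symmetric])
    then have "ln (6::real) \<le> 2" using ln_le_cancel_iff[of 6 "exp 2"] by simp
    then show ?thesis by (intro mult_left_mono) auto
  qed
  finally show ?thesis using pos by (simp add: field_simps)
qed

text \<open>On the Bohr set of radius \<delta> the weight is at least exp (-1) \<ge> 1/3, so the
  normaliser is at least a third of its size. Being a bounded multiple of the uniform density is
  what later makes the Bessel count independent of N.\<close>

lemma beta_fn_le: "beta_fn \<Gamma> \<delta> x \<le> 3 * (1 / \<delta> + 2) ^ card \<Gamma> / real CARD('a)"
proof -
  let ?S = "\<Sum>y\<in>UNIV. exp (- bnorm \<Gamma> (y::'a) / \<delta>)"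
  let ?B = "bohr \<Gamma> \<delta> :: 'a set"
  have "real (card ?B) / 3 = (\<Sum>y\<in>?B. 1 / 3)" by simp
  also have "\<dots> \<le> (\<Sum>y\<in>?B. exp (- bnorm \<Gamma> y / \<delta>))"
  proof (rule sum_mono)
    fix y assume "y \<in> ?B"
    then have "-1 \<le> - bnorm \<Gamma> y / \<delta>" using pos by (simp add: bohr_def)
    then have "exp (-1) \<le> exp (- bnorm \<Gamma> y / \<delta>)" by (simp only: exp_le_cancel_iff)
    moreover have "1 / 3 \<le> exp (-1 :: real)" using exp_le by (simp add: exp_minus field_simps)
    ultimately show "1 / 3 \<le> exp (- bnorm \<Gamma> y / \<delta>)" by linarith
  qed
  also have "\<dots> \<le> ?S" by (intro sum_mono2) auto
  finally have S: "real (card ?B) \<le> 3 * ?S" by simp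
  have pw: "0 < (1 / \<delta> + 2) ^ card \<Gamma>" using pos by (intro zero_less_power add_pos_pos) auto
  have "real CARD('a) \<le> (1 / \<delta> + 2) ^ card \<Gamma> * real (card ?B)"
    by (rule card_UNIV_le_bohr[OF fin chars pos])
  also have "\<dots> \<le> (1 / \<delta> + 2) ^ card \<Gamma> * (3 * ?S)"
    using pw S by (intro mult_left_mono) auto
  finally have N: "real CARD('a) \<le> (1 / \<delta> + 2) ^ card \<Gamma> * (3 * ?S)" .
  have "beta_fn \<Gamma> \<delta> x \<le> 1 / ?S"
    unfolding beta_fn_eq using sum_exp_bnorm_pos bnorm_nonneg[OF fin, of x] pos
    by (intro divide_right_mono) auto
  also have "\<dots> \<le> 3 * (1 / \<delta> + 2) ^ card \<Gamma> / real CARD('a)"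
    using N sum_exp_bnorm_pos pw by (simp add: field_simps)
  finally show ?thesis .
qed

lemma sym_prob_psi: "sym_prob (psi_fn \<Gamma> \<delta>)"
  unfolding psi_fn_def by (intro sym_prob_conv sym_prob_beta)

lemma psi_fn_shift: "psi_fn \<Gamma> \<delta> x \<le> exp (bnorm \<Gamma> y / \<delta>) * psi_fn \<Gamma> \<delta> (x + y)"
proof -
  have "psi_fn \<Gamma> \<delta> x \<le> (\<Sum>z\<in>UNIV. beta_fn \<Gamma> \<delta> z * (exp (bnorm \<Gamma> y / \<delta>) * beta_fn \<Gamma> \<delta> (x - z + y)))"
    unfolding psi_fn_def conv_def
    by (intro sum_mono mult_left_mono beta_fn_shift sym_probD(1)[OF sym_prob_beta])
  also have "\<dots> = exp (bnorm \<Gamma> y / \<delta>) * psi_fn \<Gamma> \<delta> (x + y)"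
    unfolding psi_fn_def conv_def by (simp add: sum_distrib_left algebra_simps)
  finally show ?thesis .
qed

lemma psi_fn_le: "psi_fn \<Gamma> \<delta> x \<le> 3 * (1 / \<delta> + 2) ^ card \<Gamma> / real CARD('a)"
proof -
  have "psi_fn \<Gamma> \<delta> x \<le> (\<Sum>z\<in>UNIV. beta_fn \<Gamma> \<delta> z * (3 * (1 / \<delta> + 2) ^ card \<Gamma> / real CARD('a)))"
    unfolding psi_fn_def conv_def
    by (intro sum_mono mult_left_mono beta_fn_le sym_probD(1)[OF sym_prob_beta])
  also have "\<dots> = 3 * (1 / \<delta> + 2) ^ card \<Gamma> / real CARD('a)"
    unfolding sum_distrib_right[symmetric] by (simp add: sym_probD(3)[OF sym_prob_beta])
  finally show ?thesis .
qed

text \<open>A \<psi>-random point is a sum of two independent \<beta>-random points, so the triangle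
  inequality doubles the constant 4.\<close>

lemma psi_fn_mean_bnorm: "(\<Sum>x\<in>UNIV. psi_fn \<Gamma> \<delta> x * bnorm \<Gamma> x) \<le> 8 * card \<Gamma> * \<delta>"
proof -
  let ?b = "beta_fn \<Gamma> \<delta>" and ?M = "\<Sum>x\<in>UNIV. beta_fn \<Gamma> \<delta> x * bnorm \<Gamma> x"
  have "(\<Sum>x\<in>UNIV. psi_fn \<Gamma> \<delta> x * bnorm \<Gamma> x) = (\<Sum>z\<in>UNIV. \<Sum>x\<in>UNIV. ?b z * ?b (x - z) * bnorm \<Gamma> x)"
    unfolding psi_fn_def conv_def sum_distrib_right by (rule sum.swap)
  also have "\<dots> = (\<Sum>z\<in>UNIV. \<Sum>x\<in>UNIV. ?b z * ?b x * bnorm \<Gamma> (x + z))"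
    using sum_group_add_shift(1)[of "\<lambda>x. ?b z * ?b (x - z) * bnorm \<Gamma> x" z for z] by simp
  also have "\<dots> \<le> (\<Sum>z\<in>UNIV. \<Sum>x\<in>UNIV. ?b z * ?b x * (bnorm \<Gamma> x + bnorm \<Gamma> z))"
    by (intro sum_mono mult_left_mono bnorm_triangle fin chars mult_nonneg_nonneg sym_probD(1)[OF sym_prob_beta])
  also have "\<dots> = (\<Sum>z\<in>UNIV. ?b z) * ?M + (\<Sum>x\<in>UNIV. ?b x) * ?M"
  proof -
    have "(\<Sum>z\<in>UNIV. \<Sum>x\<in>UNIV. ?b z * ?b x * (bnorm \<Gamma> x + bnorm \<Gamma> z)) =
      (\<Sum>z\<in>UNIV. ?b z * ?M + (\<Sum>x\<in>UNIV. ?b x) * (?b z * bnorm \<Gamma> z))"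
      by (intro sum.cong refl)
        (simp add: sum_distrib_left sum_distrib_right sum.distrib[symmetric] algebra_simps)
    then show ?thesis by (simp only: sum.distrib sum_distrib_right[symmetric] sum_distrib_left[symmetric])
  qed
  also have "\<dots> \<le> 8 * card \<Gamma> * \<delta>"
    using beta_fn_mean_bnorm by (simp only: sym_probD(3)[OF sym_prob_beta] mult_1)
  finally show ?thesis .
qed

text \<open>The pointwise comparison by exp (||y|| / \<delta>) works in both directions, since y and
  -y have the same norm. The bound holds for every y, so it can be averaged over any distribution of
  y.\<close>

lemma psi_fn_shift_L1:
  "(\<Sum>x\<in>UNIV. \<bar>psi_fn \<Gamma> \<delta> (x + y) - psi_fn \<Gamma> \<delta> x\<bar>) \<le> 2 * bnorm \<Gamma> y / \<delta>"
proof -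
  let ?p = "psi_fn \<Gamma> \<delta>" and ?u = "bnorm \<Gamma> y / \<delta>"
  \<comment> \<open>Using exp (-u) \<ge> 1 - u on the larger value gives a linear bound for all u;
    expanding exp u itself would need u small.\<close>
  have one_sided: "a - b \<le> ?u * a" if "a \<le> exp ?u * b" "0 \<le> a" for a b
  proof -
    have "(1 + - ?u) * a \<le> exp (- ?u) * a"
      using that by (intro mult_right_mono exp_ge_add_one_self)
    also have "\<dots> \<le> exp (- ?u) * (exp ?u * b)"
      using that by (intro mult_left_mono) auto
    also have "\<dots> = b" by (simp add: exp_minus)
    finally show ?thesis by (simp add: algebra_simps)
  qed
  have ptw: "\<bar>?p (x + y) - ?p x\<bar> \<le> ?u * (?p (x + y) + ?p x)" for x
  proof -
    have nn: "0 \<le> ?p z" for z by (rule sym_probD(1)[OF sym_prob_psi])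
    have "0 \<le> ?u" using bnorm_nonneg[OF fin] pos by simp
    then have "0 \<le> ?u * ?p x" "0 \<le> ?u * ?p (x + y)" using nn by (rule mult_nonneg_nonneg)+
    moreover have "?p x - ?p (x + y) \<le> ?u * ?p x" by (intro one_sided psi_fn_shift nn)
    moreover have "?p (x + y) - ?p x \<le> ?u * ?p (x + y)"
      using psi_fn_shift[of "x + y" "- y"] bnorm_minus[OF chars] by (intro one_sided nn) simp
    ultimately show ?thesis by (simp add: algebra_simps abs_le_iff)
  qed
  have "(\<Sum>x\<in>UNIV. \<bar>?p (x + y) - ?p x\<bar>) \<le> (\<Sum>x\<in>UNIV. ?u * (?p (x + y) + ?p x))"
    by (rule sum_mono) (rule ptw)
  also have "\<dots> = ?u * 2"
    by (simp only: sum_distrib_left[symmetric] sum.distrib sum_group_add_shift(1) sym_probD(3)[OF sym_prob_psi] one_add_one)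
  finally show ?thesis by (simp add: mult.commute)
qed

end

section \<open>Energy and Bessel's inequality\<close>

lemma conv_in_unit_interval:
  fixes f p :: "'a::{ab_group_add,finite} \<Rightarrow> real"
  assumes p: "sym_prob p" and f: "range f \<subseteq> {0..1}"
  shows "0 \<le> conv f p x" "conv f p x \<le> 1"
proof -
  have f: "0 \<le> f y" "f y \<le> 1" for y using f by (auto simp: image_subset_iff)
  show "0 \<le> conv f p x"
    unfolding conv_def by (intro sum_nonneg mult_nonneg_nonneg f sym_probD(1)[OF p])
  have "conv f p x \<le> (\<Sum>y\<in>UNIV. 1 * p (x - y))"
    unfolding conv_def by (intro sum_mono mult_right_mono f sym_probD(1)[OF p])
  then show "conv f p x \<le> 1" by (simp add: sum_group_add_shift sym_probD(3)[OF p])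
qed

lemma sum_conv_shift:
  fixes f p :: "'a::{ab_group_add,finite} \<Rightarrow> real"
  assumes "sym_prob p"
  shows "(\<Sum>y\<in>UNIV. f (x + y) * p y) = conv f p x"
proof -
  have "(\<Sum>y\<in>UNIV. f (x + y) * p y) = (\<Sum>y\<in>UNIV. f (x + (y - x)) * p (y - x))"
    by (rule sum_group_add_shift(3)[symmetric])
  also have "\<dots> = conv f p x"
    unfolding conv_def using sym_probD(2)[OF assms, of "x - y" for y] by simp
  finally show ?thesis .
qed

text \<open>Mean L1 distance between \<open>p\<close> and its translate by a \<open>q\<close>-random
  point. It dominates the L1 distance from \<open>p\<close> to \<open>conv p q\<close>, that is, it
  measures how nearly \<open>p\<close> absorbs the finer kernel \<open>q\<close>.\<close>

definition shift_defect :: "('a::{ab_group_add,finite} \<Rightarrow> real) \<Rightarrow> ('a \<Rightarrow> real) \<Rightarrow> real" where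
  "shift_defect p q = (\<Sum>y\<in>UNIV. q y * (\<Sum>x\<in>UNIV. \<bar>p (x + y) - p x\<bar>))"

text \<open>Both sides become double sums with the same weights \<open>f w * q y\<close>, differing
  only by a translation of \<open>p\<close>; then f \<le> 1 is used.\<close>

lemma conv_conv_approx:
  fixes f p q :: "'a::{ab_group_add,finite} \<Rightarrow> real"
  assumes p: "sym_prob p" and q: "sym_prob q" and f: "range f \<subseteq> {0..1}"
  shows "\<bar>conv (conv f q) p x - conv f p x\<bar> \<le> shift_defect p q"
proof -
  have f: "0 \<le> f y" "f y \<le> 1" for y using f by (auto simp: image_subset_iff)
  have "conv (conv f q) p x = (\<Sum>w\<in>UNIV. \<Sum>z\<in>UNIV. f w * q (z - w) * p (x - z))"
    unfolding conv_def sum_distrib_right by (rule sum.swap)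
  also have "\<dots> = (\<Sum>w\<in>UNIV. \<Sum>y\<in>UNIV. f w * q y * p (x - w - y))"
  proof (rule sum.cong[OF refl])
    fix w
    show "(\<Sum>z\<in>UNIV. f w * q (z - w) * p (x - z)) = (\<Sum>y\<in>UNIV. f w * q y * p (x - w - y))"
      using sum_group_add_shift(1)[of "\<lambda>z. f w * q (z - w) * p (x - z)" w] by (simp add: algebra_simps)
  qed
  finally have 1: "conv (conv f q) p x = (\<Sum>w\<in>UNIV. \<Sum>y\<in>UNIV. f w * q y * p (x - w - y))" .
  have 2: "conv f p x = (\<Sum>w\<in>UNIV. \<Sum>y\<in>UNIV. f w * q y * p (x - w))"
  proof -
    have "(\<Sum>y\<in>UNIV. f w * q y * p (x - w)) = f w * p (x - w) * (\<Sum>y\<in>UNIV. q y)" for w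
      unfolding sum_distrib_left by (intro sum.cong refl) simp
    then show ?thesis unfolding conv_def by (simp add: sym_probD(3)[OF q])
  qed
  have "\<bar>conv (conv f q) p x - conv f p x\<bar> \<le>
      (\<Sum>w\<in>UNIV. \<Sum>y\<in>UNIV. \<bar>f w * q y * p (x - w - y) - f w * q y * p (x - w)\<bar>)"
    unfolding 1 2 sum_subtractf[symmetric]
    by (rule order_trans[OF sum_abs sum_mono[OF sum_abs]])
  also have "\<dots> \<le> (\<Sum>w\<in>UNIV. \<Sum>y\<in>UNIV. q y * \<bar>p (x - w) - p (x - w - y)\<bar>)"
  proof (intro sum_mono)
    fix w y
    have "\<bar>f w * q y * p (x - w - y) - f w * q y * p (x - w)\<bar> = f w * (q y * \<bar>p (x - w) - p (x - w - y)\<bar>)"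
      using f(1)[of w] sym_probD(1)[OF q, of y]
      by (simp add: right_diff_distrib[symmetric] abs_mult abs_minus_commute mult.assoc)
    also have "\<dots> \<le> 1 * (q y * \<bar>p (x - w) - p (x - w - y)\<bar>)"
      by (intro mult_right_mono f mult_nonneg_nonneg sym_probD(1)[OF q]) simp
    finally show "\<bar>f w * q y * p (x - w - y) - f w * q y * p (x - w)\<bar> \<le> q y * \<bar>p (x - w) - p (x - w - y)\<bar>"
      by simp
  qed
  also have "\<dots> = (\<Sum>y\<in>UNIV. q y * (\<Sum>w\<in>UNIV. \<bar>p (x - w) - p (x - w - y)\<bar>))"
    unfolding sum_distrib_left by (rule sum.swap)
  also have "\<dots> = shift_defect p q"
    unfolding shift_defect_def
  proof (rule sum.cong[OF refl])
    fix y
    have "(\<Sum>w\<in>UNIV. \<bar>p (x - w) - p (x - w - y)\<bar>) = (\<Sum>w\<in>UNIV. \<bar>p w - p (w - y)\<bar>)"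
      by (rule sum_group_add_shift(4))
    also have "\<dots> = (\<Sum>w\<in>UNIV. \<bar>p (w + y) - p w\<bar>)"
      using sum_group_add_shift(1)[of "\<lambda>w. \<bar>p w - p (w - y)\<bar>" y] by simp
    finally show "q y * (\<Sum>w\<in>UNIV. \<bar>p (x - w) - p (x - w - y)\<bar>) = q y * (\<Sum>w\<in>UNIV. \<bar>p (w + y) - p w\<bar>)"
      by simp
  qed
  finally show ?thesis .
qed

lemma shift_defect_nonneg: "sym_prob q \<Longrightarrow> 0 \<le> shift_defect p q"
  unfolding shift_defect_def by (intro sum_nonneg mult_nonneg_nonneg) (auto intro: sym_probD)

text \<open>An approximate Pythagoras: after expanding the square, the cross term pairs the coarse
  density with the \<open>p\<close>-average of the fine one, and this average is the coarse density
  up to the shift defect.\<close>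

lemma local_variance_le_energy_gain:
  fixes f p q :: "'a::{ab_group_add,finite} \<Rightarrow> real"
  assumes p: "sym_prob p" and q: "sym_prob q" and f: "range f \<subseteq> {0..1}"
  shows "(\<Sum>x\<in>UNIV. \<Sum>y\<in>UNIV. (conv f q (x + y) - conv f p x)\<^sup>2 * p y)
    \<le> (\<Sum>x\<in>UNIV. (conv f q x)\<^sup>2) - (\<Sum>x\<in>UNIV. (conv f p x)\<^sup>2) + 2 * shift_defect p q * CARD('a)"
proof -
  let ?a = "conv f p" and ?b = "conv f q" and ?k = "shift_defect p q"
  have "(\<Sum>x\<in>UNIV. \<Sum>y\<in>UNIV. (?b (x + y) - ?a x)\<^sup>2 * p y) =
      (\<Sum>x\<in>UNIV. (\<Sum>y\<in>UNIV. (?b (x + y))\<^sup>2 * p y) + (?a x)\<^sup>2 * (\<Sum>y\<in>UNIV. p y) - 2 * ?a x * (\<Sum>y\<in>UNIV. ?b (x + y) * p y))"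
    unfolding sum_distrib_left sum.distrib[symmetric] sum_subtractf[symmetric]
    by (intro sum.cong refl) (simp add: power2_eq_square algebra_simps)
  also have "\<dots> = (\<Sum>x\<in>UNIV. \<Sum>y\<in>UNIV. (?b (x + y))\<^sup>2 * p y) + (\<Sum>x\<in>UNIV. (?a x)\<^sup>2)
      - 2 * (\<Sum>x\<in>UNIV. ?a x * conv ?b p x)"
    by (simp add: sum_conv_shift[OF p] sym_probD(3)[OF p] sum.distrib sum_subtractf sum_distrib_left mult.assoc)
  also have "(\<Sum>x\<in>UNIV. \<Sum>y\<in>UNIV. (?b (x + y))\<^sup>2 * p y) = (\<Sum>y\<in>UNIV. \<Sum>x\<in>UNIV. (?b (x + y))\<^sup>2 * p y)"
    by (rule sum.swap)
  also have "\<dots> = (\<Sum>y\<in>UNIV. (\<Sum>x\<in>UNIV. (?b x)\<^sup>2) * p y)"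
    unfolding sum_distrib_right[symmetric] by (subst sum_group_add_shift(1)[of "\<lambda>x. (?b x)\<^sup>2"]) (rule refl)
  also have "\<dots> = (\<Sum>x\<in>UNIV. (?b x)\<^sup>2)"
    by (simp add: sum_distrib_left[symmetric] sym_probD(3)[OF p])
  finally have eq: "(\<Sum>x\<in>UNIV. \<Sum>y\<in>UNIV. (?b (x + y) - ?a x)\<^sup>2 * p y) =
    (\<Sum>x\<in>UNIV. (?b x)\<^sup>2) + (\<Sum>x\<in>UNIV. (?a x)\<^sup>2) - 2 * (\<Sum>x\<in>UNIV. ?a x * conv ?b p x)" .
  \<comment> \<open>Since the coarse density lies in [0, 1], the cross term loses at most one defect
    per point.\<close>
  have "(\<Sum>x\<in>UNIV. (?a x)\<^sup>2 - ?k) \<le> (\<Sum>x\<in>UNIV. ?a x * conv ?b p x)"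
  proof (rule sum_mono)
    fix x
    have a: "0 \<le> ?a x" "?a x \<le> 1" by (auto intro: conv_in_unit_interval[OF p f])
    have "?a x * (?a x - ?k) \<le> ?a x * conv ?b p x"
      using conv_conv_approx[OF p q f, of x] a by (intro mult_left_mono) auto
    moreover have "?a x * ?k \<le> 1 * ?k" using a shift_defect_nonneg[OF q] by (intro mult_right_mono) auto
    ultimately show "(?a x)\<^sup>2 - ?k \<le> ?a x * conv ?b p x"
      by (simp add: power2_eq_square algebra_simps)
  qed
  then have "(\<Sum>x\<in>UNIV. (?a x)\<^sup>2) - ?k * CARD('a) \<le> (\<Sum>x\<in>UNIV. ?a x * conv ?b p x)"
    by (simp add: sum_subtractf mult.commute)
  then show ?thesis unfolding eq by simp
qed

text \<open>Controls the sets that are not known to gain, and the intermediate passage to the second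
  scale before characters are adjoined.\<close>

lemma energy_almost_monotone:
  fixes f p q :: "'a::{ab_group_add,finite} \<Rightarrow> real"
  assumes p: "sym_prob p" and q: "sym_prob q" and f: "range f \<subseteq> {0..1}"
  shows "(\<Sum>x\<in>UNIV. (conv f p x)\<^sup>2) \<le> (\<Sum>x\<in>UNIV. (conv f q x)\<^sup>2) + 2 * shift_defect p q * CARD('a)"
proof -
  have "0 \<le> (\<Sum>x\<in>UNIV. \<Sum>y\<in>UNIV. (conv f q (x + y) - conv f p x)\<^sup>2 * p y)"
    by (intro sum_nonneg mult_nonneg_nonneg sym_probD(1)[OF p]) auto
  then show ?thesis using local_variance_le_energy_gain[OF p q f] by simp
qed

lemma energy_gain_of_local_variance:
  fixes f p q :: "'a::{ab_group_add,finite} \<Rightarrow> real"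
  assumes p: "sym_prob p" and q: "sym_prob q" and f: "range f \<subseteq> {0..1}"
    and X: "\<And>x. x \<in> X \<Longrightarrow> c \<le> (\<Sum>y\<in>UNIV. (conv f q (x + y) - conv f p x)\<^sup>2 * p y)"
  shows "(\<Sum>x\<in>UNIV. (conv f p x)\<^sup>2) + c * card X \<le> (\<Sum>x\<in>UNIV. (conv f q x)\<^sup>2) + 2 * shift_defect p q * CARD('a)"
proof -
  have "c * card X = (\<Sum>x\<in>X. c)" by simp
  also have "\<dots> \<le> (\<Sum>x\<in>X. \<Sum>y\<in>UNIV. (conv f q (x + y) - conv f p x)\<^sup>2 * p y)"
    by (rule sum_mono) (rule X)
  also have "\<dots> \<le> (\<Sum>x\<in>UNIV. \<Sum>y\<in>UNIV. (conv f q (x + y) - conv f p x)\<^sup>2 * p y)"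
    by (intro sum_mono2 sum_nonneg mult_nonneg_nonneg sym_probD(1)[OF p]) auto
  finally show ?thesis using local_variance_le_energy_gain[OF p q f] by simp
qed

section \<open>Orthogonality, Bessel's inequality and counting characters\<close>

text \<open>Translating the summation variable by m multiplies the sum by
  \<open>\<gamma> m * cnj (\<gamma>' m)\<close>, which differs from 1 wherever the characters
  differ.\<close>

lemma character_orthogonality:
  fixes \<gamma> \<gamma>' :: "'a::{ab_group_add,finite} \<Rightarrow> complex"
  assumes g: "character \<gamma>" "character \<gamma>'"
  shows "(\<Sum>n\<in>UNIV. \<gamma> n * cnj (\<gamma>' n)) = (if \<gamma> = \<gamma>' then of_nat CARD('a) else 0)"
proof (cases "\<gamma> = \<gamma>'")
  case True
  have "\<gamma>' n * cnj (\<gamma>' n) = 1" for n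
    by (simp add: complex_norm_square[symmetric] character_norm[OF g(2)])
  with True show ?thesis by simp
next
  case False
  then obtain m where m: "\<gamma> m \<noteq> \<gamma>' m" by auto
  let ?S = "\<Sum>n\<in>UNIV. \<gamma> n * cnj (\<gamma>' n)"
  have "?S = (\<Sum>n\<in>UNIV. \<gamma> (n + m) * cnj (\<gamma>' (n + m)))"
    by (rule sum_group_add_shift(1)[symmetric])
  also have "\<dots> = \<gamma> m * cnj (\<gamma>' m) * ?S"
    unfolding sum_distrib_left character_add[OF g(1)] character_add[OF g(2)]
    by (intro sum.cong refl) simp
  finally have "?S * (1 - \<gamma> m * cnj (\<gamma>' m)) = 0" by (simp add: algebra_simps)
  moreover have "\<gamma> m * cnj (\<gamma>' m) \<noteq> 1"
  proof
    assume *: "\<gamma> m * cnj (\<gamma>' m) = 1"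
    have "cnj (\<gamma>' m) * \<gamma>' m = 1"
      using complex_norm_square[of "\<gamma>' m"] character_norm[OF g(2), of m] by (simp add: mult.commute)
    then have "\<gamma> m = \<gamma> m * (cnj (\<gamma>' m) * \<gamma>' m)" by simp
    also have "\<dots> = \<gamma>' m" using * by (simp add: mult.assoc[symmetric])
    finally show False using m by simp
  qed
  ultimately show ?thesis using False by simp
qed

lemma Bessel_inequality:
  fixes f :: "'a::{ab_group_add,finite} \<Rightarrow> complex"
  assumes fin: "finite \<Gamma>" and chars: "\<Gamma> \<subseteq> {\<gamma>. character \<gamma>}"
  shows "(\<Sum>\<gamma>\<in>\<Gamma>. (cmod (\<Sum>n\<in>UNIV. f n * \<gamma> n))\<^sup>2) \<le> CARD('a) * (\<Sum>n\<in>UNIV. (cmod (f n))\<^sup>2)"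
proof -
  define c where "c \<gamma> = (\<Sum>n\<in>UNIV. f n * \<gamma> n)" for \<gamma>
  \<comment> \<open>N times the orthogonal projection of \<open>f\<close> onto the span of the
    conjugate characters, conjugate because the coefficients pair \<open>f\<close> with \<gamma>
    itself. The inequality is nonnegativity of the squared norm of N f - g.\<close>
  define g where "g n = (\<Sum>\<gamma>\<in>\<Gamma>. c \<gamma> * cnj (\<gamma> n))" for n
  let ?N = "of_nat CARD('a) :: complex"
  let ?C = "\<Sum>\<gamma>\<in>\<Gamma>. c \<gamma> * cnj (c \<gamma>)"
  have fg: "(\<Sum>n\<in>UNIV. f n * cnj (g n)) = ?C"
  proof -
    have "(\<Sum>n\<in>UNIV. f n * cnj (g n)) = (\<Sum>n\<in>UNIV. \<Sum>\<gamma>\<in>\<Gamma>. f n * \<gamma> n * cnj (c \<gamma>))"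
      unfolding g_def by (simp add: sum_distrib_left mult_ac)
    also have "\<dots> = (\<Sum>\<gamma>\<in>\<Gamma>. \<Sum>n\<in>UNIV. f n * \<gamma> n * cnj (c \<gamma>))" by (rule sum.swap)
    finally show ?thesis by (simp add: sum_distrib_right[symmetric] c_def)
  qed
  have gf: "(\<Sum>n\<in>UNIV. g n * cnj (f n)) = ?C"
    using arg_cong[OF fg, of cnj] by (simp add: mult.commute)
  have gg: "(\<Sum>n\<in>UNIV. g n * cnj (g n)) = ?N * ?C"
  proof -
    have "(\<Sum>n\<in>UNIV. g n * cnj (g n)) = (\<Sum>n\<in>UNIV. \<Sum>\<gamma>\<in>\<Gamma>. c \<gamma> * cnj (\<gamma> n) * cnj (g n))"
      unfolding g_def by (simp only: sum_distrib_right)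
    also have "\<dots> = (\<Sum>\<gamma>\<in>\<Gamma>. c \<gamma> * (\<Sum>n\<in>UNIV. cnj (\<gamma> n) * cnj (g n)))"
      by (subst sum.swap) (simp add: sum_distrib_left mult.assoc)
    also have "\<dots> = (\<Sum>\<gamma>\<in>\<Gamma>. c \<gamma> * (?N * cnj (c \<gamma>)))"
    proof (intro sum.cong refl arg_cong2[where f = "(*)"])
      fix \<gamma> assume gam: "\<gamma> \<in> \<Gamma>"
      have "(\<Sum>n\<in>UNIV. cnj (\<gamma> n) * cnj (g n)) = (\<Sum>n\<in>UNIV. \<Sum>\<gamma>'\<in>\<Gamma>. cnj (c \<gamma>') * (\<gamma>' n * cnj (\<gamma> n)))"
        unfolding g_def by (simp add: sum_distrib_left mult_ac)
      also have "\<dots> = (\<Sum>\<gamma>'\<in>\<Gamma>. cnj (c \<gamma>') * (\<Sum>n\<in>UNIV. \<gamma>' n * cnj (\<gamma> n)))"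
        by (subst sum.swap) (simp add: sum_distrib_left)
      also have "\<dots> = (\<Sum>\<gamma>'\<in>\<Gamma>. if \<gamma>' = \<gamma> then ?N * cnj (c \<gamma>) else 0)"
      proof (rule sum.cong[OF refl])
        fix \<gamma>' assume "\<gamma>' \<in> \<Gamma>"
        then have "(\<Sum>n\<in>UNIV. \<gamma>' n * cnj (\<gamma> n)) = (if \<gamma>' = \<gamma> then ?N else 0)"
          using chars gam by (intro character_orthogonality) auto
        then show "cnj (c \<gamma>') * (\<Sum>n\<in>UNIV. \<gamma>' n * cnj (\<gamma> n)) = (if \<gamma>' = \<gamma> then ?N * cnj (c \<gamma>) else 0)"
          by simp
      qed
      also have "\<dots> = ?N * cnj (c \<gamma>)" using fin gam by simp
      finally show "(\<Sum>n\<in>UNIV. cnj (\<gamma> n) * cnj (g n)) = ?N * cnj (c \<gamma>)" .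
    qed
    finally show ?thesis by (simp add: sum_distrib_left mult_ac)
  qed
  have "complex_of_real (\<Sum>n\<in>UNIV. (cmod (?N * f n - g n))\<^sup>2) = (\<Sum>n\<in>UNIV. (?N * f n - g n) * cnj (?N * f n - g n))"
    unfolding of_real_sum complex_norm_square ..
  also have "\<dots> = ?N * ?N * (\<Sum>n\<in>UNIV. f n * cnj (f n)) - ?N * (\<Sum>n\<in>UNIV. f n * cnj (g n))
      - ?N * (\<Sum>n\<in>UNIV. g n * cnj (f n)) + (\<Sum>n\<in>UNIV. g n * cnj (g n))"
    unfolding sum_distrib_left sum.distrib[symmetric] sum_subtractf[symmetric]
    by (intro sum.cong refl) (simp add: algebra_simps)
  also have "\<dots> = ?N * (?N * (\<Sum>n\<in>UNIV. f n * cnj (f n)) - ?C)"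
    unfolding fg gf gg by (simp add: algebra_simps)
  also have "\<dots> = complex_of_real (CARD('a) * (CARD('a) * (\<Sum>n\<in>UNIV. (cmod (f n))\<^sup>2) - (\<Sum>\<gamma>\<in>\<Gamma>. (cmod (c \<gamma>))\<^sup>2)))"
    by (simp add: complex_norm_square del: of_real_power)
  finally have "(\<Sum>n\<in>UNIV. (cmod (?N * f n - g n))\<^sup>2) =
      CARD('a) * (CARD('a) * (\<Sum>n\<in>UNIV. (cmod (f n))\<^sup>2) - (\<Sum>\<gamma>\<in>\<Gamma>. (cmod (c \<gamma>))\<^sup>2))"
    using of_real_eq_iff by blast
  moreover have "0 \<le> (\<Sum>n\<in>UNIV. (cmod (?N * f n - g n))\<^sup>2)" by (intro sum_nonneg) auto
  ultimately show ?thesis by (simp add: zero_le_mult_iff c_def)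
qed

text \<open>Bessel for each \<open>F x\<close>, summed over x. A character may have its large
  coefficients at any x, as only its total mass counts.\<close>

lemma card_characters_of_large_mass:
  fixes F :: "'b \<Rightarrow> 'a::{ab_group_add,finite} \<Rightarrow> complex" and c M :: real
  assumes "c > 0" and chars: "S \<subseteq> {\<gamma>. character \<gamma>}"
    and large: "\<And>\<gamma>. \<gamma> \<in> S \<Longrightarrow> c \<le> (\<Sum>x\<in>X. (cmod (\<Sum>n\<in>UNIV. F x n * \<gamma> n))\<^sup>2)"
    and M: "(\<Sum>x\<in>X. \<Sum>n\<in>UNIV. (cmod (F x n))\<^sup>2) \<le> M"
  shows "finite S \<and> card S * c \<le> CARD('a) * M"
proof
  have bd: "card T * c \<le> CARD('a) * M" if T: "T \<subseteq> S" "finite T" for T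
  proof -
    have "card T * c = (\<Sum>\<gamma>\<in>T. c)" by simp
    also have "\<dots> \<le> (\<Sum>\<gamma>\<in>T. \<Sum>x\<in>X. (cmod (\<Sum>n\<in>UNIV. F x n * \<gamma> n))\<^sup>2)"
      using large T by (intro sum_mono) auto
    also have "\<dots> = (\<Sum>x\<in>X. \<Sum>\<gamma>\<in>T. (cmod (\<Sum>n\<in>UNIV. F x n * \<gamma> n))\<^sup>2)" by (rule sum.swap)
    also have "\<dots> \<le> (\<Sum>x\<in>X. CARD('a) * (\<Sum>n\<in>UNIV. (cmod (F x n))\<^sup>2))"
      using chars T by (intro sum_mono Bessel_inequality) auto
    also have "\<dots> \<le> CARD('a) * M"
      unfolding sum_distrib_left[symmetric] using M by (intro mult_left_mono) auto
    finally show ?thesis .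
  qed
  \<comment> \<open>A uniform bound on all finite subsets yields finiteness of \<open>S\<close>,
    after which the bound applies to \<open>S\<close> itself.\<close>
  have "card T \<le> nat \<lfloor>CARD('a) * M / c\<rfloor>" if "T \<subseteq> S" "finite T" for T
    using bd[OF that] \<open>c > 0\<close> by (simp add: le_nat_floor pos_le_divide_eq)
  then show "finite S" by (meson finite_if_finite_subsets_card_bdd)
  then show "card S * c \<le> CARD('a) * M" using bd by blast
qed

section \<open>Large local Fourier coefficients\<close>

lemma conv_commute: "conv f g x = (\<Sum>y\<in>UNIV. g y * f (x - y))"
  unfolding conv_def
  using sum_group_add_shift(4)[of "\<lambda>y. f y * g (x - y)" x] by (simp add: mult.commute)

text \<open>Since R is contained in R', the R-norm is at most the R'-norm, whose mean under the
  finer kernel is known. The case R = R' serves the pure change of scale.\<close>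

lemma shift_defect_psi_le:
  fixes R R' :: "('a::{ab_group_add,finite} \<Rightarrow> complex) set" and \<eta> \<eta>' :: real
  assumes fin: "finite R'" and chars: "R' \<subseteq> {\<gamma>. character \<gamma>}" and sub: "R \<subseteq> R'"
    and pos: "\<eta> > 0" "\<eta>' > 0"
  shows "shift_defect (psi_fn R \<eta>) (psi_fn R' \<eta>') \<le> 16 * card R' * \<eta>' / \<eta>"
proof -
  have R: "finite R" "R \<subseteq> {\<gamma>. character \<gamma>}" using fin chars sub by (auto intro: finite_subset)
  have q: "0 \<le> psi_fn R' \<eta>' y" for y by (rule sym_probD(1)[OF sym_prob_psi[OF fin chars pos(2)]])
  have "shift_defect (psi_fn R \<eta>) (psi_fn R' \<eta>') \<le> (\<Sum>y\<in>UNIV. psi_fn R' \<eta>' y * (2 * bnorm R y / \<eta>))"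
    unfolding shift_defect_def by (intro sum_mono mult_left_mono psi_fn_shift_L1 R pos q)
  also have "\<dots> \<le> (\<Sum>y\<in>UNIV. psi_fn R' \<eta>' y * (2 * bnorm R' y / \<eta>))"
    using pos by (intro sum_mono mult_left_mono divide_right_mono bnorm_mono fin sub q) auto
  also have "\<dots> = 2 / \<eta> * (\<Sum>y\<in>UNIV. psi_fn R' \<eta>' y * bnorm R' y)"
    unfolding sum_distrib_left by (intro sum.cong refl) simp
  also have "\<dots> \<le> 2 / \<eta> * (8 * card R' * \<eta>')"
    using pos by (intro mult_left_mono psi_fn_mean_bnorm fin chars) auto
  finally show ?thesis by (simp add: mult_ac)
qed

text \<open>Condition (ii) subtracts a density that depends on x. Splitting it off leaves
  coefficients of \<open>f\<close> and of the kernel alone; as the density is at most 1, one of the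
  two exceeds half of a large balanced coefficient.\<close>

definition large_spec :: "real \<Rightarrow> ('a::{ab_group_add,finite} \<Rightarrow> real) \<Rightarrow> ('a \<Rightarrow> real) \<Rightarrow> ('a \<Rightarrow> complex) set" where
  "large_spec \<theta> f p = {\<gamma>. character \<gamma> \<and>
     (\<theta> < cmod (\<Sum>n\<in>UNIV. complex_of_real (p n) * \<gamma> n) \<or>
      (\<exists>x. \<theta> < cmod (\<Sum>n\<in>UNIV. complex_of_real (f (x + n) * p n) * \<gamma> n)))}"

lemma mem_large_specI:
  fixes f p :: "'a::{ab_group_add,finite} \<Rightarrow> real"
  assumes "character \<gamma>" "\<bar>c\<bar> \<le> 1"
    and large: "2 * \<theta> < cmod (\<Sum>n\<in>UNIV. complex_of_real ((f (x + n) - c) * p n) * \<gamma> n)"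
  shows "\<gamma> \<in> large_spec \<theta> f p"
proof -
  let ?P = "\<Sum>n\<in>UNIV. complex_of_real (f (x + n) * p n) * \<gamma> n"
  let ?Q = "\<Sum>n\<in>UNIV. complex_of_real (p n) * \<gamma> n"
  have "(\<Sum>n\<in>UNIV. complex_of_real ((f (x + n) - c) * p n) * \<gamma> n) = ?P - complex_of_real c * ?Q"
    unfolding sum_distrib_left sum_subtractf[symmetric] by (intro sum.cong refl) (simp add: algebra_simps)
  then have "2 * \<theta> < cmod ?P + \<bar>c\<bar> * cmod ?Q"
    using large norm_triangle_ineq4[of ?P "complex_of_real c * ?Q"] by (simp add: norm_mult)
  also have "\<dots> \<le> cmod ?P + 1 * cmod ?Q" using assms(2) by (intro add_left_mono mult_right_mono) auto
  finally have "\<theta> < cmod ?P \<or> \<theta> < cmod ?Q" by linarith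
  then show ?thesis using assms(1) unfolding large_spec_def by auto
qed

text \<open>A large local coefficient at \<open>x\<close> stays large (up to a phase) at all translates of \<open>x\<close> by a
  small Bohr set, so Bessel's inequality summed over all \<open>x\<close> bounds the number of characters.\<close>

lemma card_large_spec_le:
  fixes \<Gamma> :: "('a::{ab_group_add,finite} \<Rightarrow> complex) set" and f :: "'a \<Rightarrow> real"
  assumes fin: "finite \<Gamma>" and chars: "\<Gamma> \<subseteq> {\<gamma>. character \<gamma>}" and pos: "\<delta> > 0"
    and \<theta>: "0 < \<theta>" "\<theta> \<le> 1" and f: "range f \<subseteq> {0..1}"
  defines "S \<equiv> large_spec \<theta> f (psi_fn \<Gamma> \<delta>)"
  shows "finite S" "card S \<le> 15 * (4 / (\<theta> * \<delta>) + 2) ^ (2 * card \<Gamma>) / \<theta>\<^sup>2"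
proof -
  let ?p = "psi_fn \<Gamma> \<delta>"
  let ?N = "real CARD('a)"
  let ?d = "card \<Gamma>"
  let ?V = "4 / (\<theta> * \<delta>) + 2"
  let ?P = "\<lambda>x \<gamma>. \<Sum>n\<in>UNIV. complex_of_real (f (x + n) * ?p n) * \<gamma> n"
  define K where "K = 3 * (1 / \<delta> + 2) ^ ?d"
  \<comment> \<open>At this radius the L1 translation bound 2 ||h|| / \<delta> is at most
    \<theta>/2, so half of the coefficient survives.\<close>
  define B where "B = (bohr \<Gamma> (\<theta> * \<delta> / 4) :: 'a set)"
  define S1 where "S1 = {\<gamma>. character \<gamma> \<and> \<theta> < cmod (\<Sum>n\<in>UNIV. complex_of_real (?p n) * \<gamma> n)}"
  define S2 where "S2 = {\<gamma>. character \<gamma> \<and> (\<exists>x. \<theta> < cmod (?P x \<gamma>))}"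
  note pp = sym_probD[OF sym_prob_psi[OF fin chars pos]]
  have f: "0 \<le> f y" "f y \<le> 1" for y using f by (auto simp: image_subset_iff)
  have Npos: "?N > 0" by simp
  have p2: "(\<Sum>n\<in>UNIV. (?p n)\<^sup>2) \<le> K / ?N"
  proof -
    have "(\<Sum>n\<in>UNIV. (?p n)\<^sup>2) \<le> (\<Sum>n\<in>UNIV. K / ?N * ?p n)"
      unfolding power2_eq_square K_def by (intro sum_mono mult_right_mono psi_fn_le fin chars pos pp)
    then show ?thesis by (simp only: sum_distrib_left[symmetric] pp(3) mult_1_right)
  qed
  have V1: "1 / \<delta> + 2 \<le> ?V"
  proof -
    have "1 / \<delta> \<le> 4 / (\<theta> * \<delta>)" using pos \<theta> by (simp add: field_simps)
    then show ?thesis by simp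
  qed
  have V2: "1 \<le> ?V" using pos \<theta> by simp
  have K: "K \<le> 3 * ?V ^ ?d" unfolding K_def using V1 pos by (intro mult_left_mono power_mono) auto
  \<comment> \<open>The coefficients of the kernel itself do not involve x, so a one-point index set
    suffices.\<close>
  have S1: "finite S1 \<and> card S1 * \<theta>\<^sup>2 \<le> ?N * (K / ?N)"
  proof (rule card_characters_of_large_mass[where X = "{()}" and F = "\<lambda>_ n. complex_of_real (?p n)"])
    show "0 < \<theta>\<^sup>2" using \<theta> by simp
    show "S1 \<subseteq> {\<gamma>. character \<gamma>}" unfolding S1_def by auto
    show "(\<Sum>x\<in>{()}. \<Sum>n\<in>UNIV. (cmod (complex_of_real (?p n)))\<^sup>2) \<le> K / ?N" using p2 by simp
    show "\<theta>\<^sup>2 \<le> (\<Sum>x\<in>{()}. (cmod (\<Sum>n\<in>UNIV. complex_of_real (?p n) * \<gamma> n))\<^sup>2)" if "\<gamma> \<in> S1" for \<gamma>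
      using that \<theta> unfolding S1_def by (auto intro: power_mono)
  qed
  have Bpos: "card B > 0"
  proof -
    have "0 \<in> B" unfolding B_def bohr_def using chars pos \<theta>
      by (intro CollectI bnorm_leI fin) (auto simp: character_zero)
    then show ?thesis by (auto simp: card_gt_0_iff)
  qed
  \<comment> \<open>Each character collects mass (\<theta>/2)^2 from every translate in
    \<open>B\<close>, while the total mass over the N base points is at most N times K/N.\<close>
  have S2: "finite S2 \<and> card S2 * (card B * (\<theta> / 2)\<^sup>2) \<le> ?N * K"
  proof (rule card_characters_of_large_mass[where X = UNIV and F = "\<lambda>x n. complex_of_real (f (x + n) * ?p n)"])
    show "0 < card B * (\<theta> / 2)\<^sup>2" using \<theta> Bpos by simp
    show "S2 \<subseteq> {\<gamma>. character \<gamma>}" unfolding S2_def by auto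
    have "(\<Sum>n\<in>UNIV. (cmod (complex_of_real (f (x + n) * ?p n)))\<^sup>2) \<le> (\<Sum>n\<in>UNIV. (?p n)\<^sup>2)" for x
    proof (rule sum_mono)
      fix n
      have "(f (x + n) * ?p n)\<^sup>2 \<le> (1 * ?p n)\<^sup>2"
        by (intro power_mono mult_right_mono mult_nonneg_nonneg f pp(1))
      then show "(cmod (complex_of_real (f (x + n) * ?p n)))\<^sup>2 \<le> (?p n)\<^sup>2"
        by (simp add: norm_mult power_mult_distrib)
    qed
    then have "(\<Sum>x\<in>UNIV. \<Sum>n\<in>UNIV. (cmod (complex_of_real (f (x + n) * ?p n)))\<^sup>2) \<le> (\<Sum>x\<in>(UNIV::'a set). K / ?N)"
      using p2 by (intro sum_mono) (rule order_trans)
    also have "\<dots> = K" using Npos by simp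
    finally show "(\<Sum>x\<in>UNIV. \<Sum>n\<in>UNIV. (cmod (complex_of_real (f (x + n) * ?p n)))\<^sup>2) \<le> K" .
    fix \<gamma> assume "\<gamma> \<in> S2"
    then obtain x where ch: "character \<gamma>" and x: "\<theta> < cmod (?P x \<gamma>)" unfolding S2_def by auto
    have shift: "\<theta> / 2 \<le> cmod (?P (x + h) \<gamma>)" if "h \<in> B" for h
    proof -
      let ?Q = "\<Sum>n\<in>UNIV. complex_of_real (f (x + n) * ?p (n - h)) * \<gamma> n"
      \<comment> \<open>Moving the base point by h amounts to translating the kernel instead, up to
        the unimodular factor \<gamma>(-h).\<close>
      have "?P (x + h) \<gamma> = (\<Sum>n\<in>UNIV. complex_of_real (f (x + n) * ?p (n - h)) * \<gamma> (n - h))"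
        using sum_group_add_shift(3)[of "\<lambda>n. complex_of_real (f (x + h + n) * ?p n) * \<gamma> n" h]
        by (simp add: algebra_simps)
      also have "\<dots> = \<gamma> (- h) * (\<Sum>n\<in>UNIV. complex_of_real (f (x + n) * ?p (n - h)) * \<gamma> n)"
        unfolding sum_distrib_left
        using character_add[OF ch, of n "- h" for n] by (intro sum.cong refl) simp
      finally have "cmod (?P (x + h) \<gamma>) = cmod (\<Sum>n\<in>UNIV. complex_of_real (f (x + n) * ?p (n - h)) * \<gamma> n)"
        by (simp add: norm_mult character_norm[OF ch])
      moreover have "cmod ((\<Sum>n\<in>UNIV. complex_of_real (f (x + n) * ?p (n - h)) * \<gamma> n) - ?P x \<gamma>) \<le> \<theta> / 2"
      proof -
        have "cmod ((\<Sum>n\<in>UNIV. complex_of_real (f (x + n) * ?p (n - h)) * \<gamma> n) - ?P x \<gamma>)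
          \<le> (\<Sum>n\<in>UNIV. \<bar>?p (n + - h) - ?p n\<bar>)"
          unfolding sum_subtractf[symmetric]
        proof (rule sum_norm_le)
          fix n
          have "complex_of_real (f (x + n) * ?p (n - h)) * \<gamma> n - complex_of_real (f (x + n) * ?p n) * \<gamma> n
            = complex_of_real (f (x + n) * (?p (n + - h) - ?p n)) * \<gamma> n"
            by (simp add: algebra_simps)
          then have "cmod (complex_of_real (f (x + n) * ?p (n - h)) * \<gamma> n - complex_of_real (f (x + n) * ?p n) * \<gamma> n)
            = f (x + n) * \<bar>?p (n + - h) - ?p n\<bar>"
            using f by (simp add: norm_mult character_norm[OF ch] abs_mult del: of_real_mult)
          also have "\<dots> \<le> 1 * \<bar>?p (n + - h) - ?p n\<bar>" by (intro mult_right_mono f) simp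
          finally show "cmod (complex_of_real (f (x + n) * ?p (n - h)) * \<gamma> n - complex_of_real (f (x + n) * ?p n) * \<gamma> n)
            \<le> \<bar>?p (n + - h) - ?p n\<bar>" by simp
        qed
        also have "\<dots> \<le> 2 * bnorm \<Gamma> (- h) / \<delta>" by (rule psi_fn_shift_L1[OF fin chars pos])
        also have "\<dots> \<le> 2 * (\<theta> * \<delta> / 4) / \<delta>"
          using that pos unfolding B_def bohr_def
          by (intro divide_right_mono mult_left_mono) (auto simp: bnorm_minus[OF chars])
        also have "\<dots> = \<theta> / 2" using pos by simp
        finally show ?thesis .
      qed
      moreover have "cmod (?P x \<gamma>) - cmod ?Q \<le> cmod (?Q - ?P x \<gamma>)"
        by (subst norm_minus_commute) (rule norm_triangle_ineq2)
      ultimately show ?thesis using x by linarith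
    qed
    have "card B * (\<theta> / 2)\<^sup>2 = (\<Sum>h\<in>B. (\<theta> / 2)\<^sup>2)" by simp
    also have "\<dots> \<le> (\<Sum>h\<in>B. (cmod (?P (x + h) \<gamma>))\<^sup>2)"
      using shift \<theta> by (intro sum_mono power_mono) auto
    also have "\<dots> \<le> (\<Sum>h\<in>UNIV. (cmod (?P (x + h) \<gamma>))\<^sup>2)" by (intro sum_mono2) auto
    also have "\<dots> = (\<Sum>h\<in>UNIV. (cmod (?P h \<gamma>))\<^sup>2)" by (rule sum_group_add_shift(2))
    finally show "card B * (\<theta> / 2)\<^sup>2 \<le> (\<Sum>x\<in>UNIV. (cmod (?P x \<gamma>))\<^sup>2)" .
  qed
  have SS: "S = S1 \<union> S2" unfolding S_def S1_def S2_def large_spec_def by auto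
  then show "finite S" using S1 S2 by simp
  have Vd: "1 \<le> ?V ^ ?d" using V2 by (rule one_le_power)
  have c1: "card S1 * \<theta>\<^sup>2 \<le> 3 * ?V ^ (2 * ?d)"
  proof -
    have "card S1 * \<theta>\<^sup>2 \<le> 3 * ?V ^ ?d" using conjunct2[OF S1] K by simp
    also have "\<dots> \<le> 3 * ?V ^ (2 * ?d)" using V2 by (intro mult_left_mono power_increasing) auto
    finally show ?thesis .
  qed
  \<comment> \<open>One power \<open>?V ^ ?d\<close> comes from the sup bound on \<psi>, the other
    from the density of \<open>B\<close>; the factor 12 is 3 divided by (1/2)^2.\<close>
  have c2: "card S2 * \<theta>\<^sup>2 \<le> 12 * ?V ^ (2 * ?d)"
  proof -
    have "?N \<le> (1 / (\<theta> * \<delta> / 4) + 2) ^ ?d * real (card B)"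
      unfolding B_def using \<theta> pos by (intro card_UNIV_le_bohr fin chars) auto
    also have "1 / (\<theta> * \<delta> / 4) + 2 = ?V" by simp
    finally have NB: "?N \<le> ?V ^ ?d * card B" .
    have "card S2 * (\<theta> / 2)\<^sup>2 * card B \<le> ?N * K" using conjunct2[OF S2] by (simp add: mult_ac)
    also have "\<dots> \<le> (?V ^ ?d * card B) * (3 * ?V ^ ?d)"
      using NB K V2 Vd by (intro mult_mono) (auto simp: K_def pos less_imp_le)
    also have "\<dots> = (3 * ?V ^ (2 * ?d)) * card B" by (simp add: mult_2 power_add)
    finally have "card S2 * (\<theta> / 2)\<^sup>2 \<le> 3 * ?V ^ (2 * ?d)" using Bpos by simp
    then show ?thesis by (simp add: power2_eq_square)
  qed
  have "card S * \<theta>\<^sup>2 \<le> (card S1 + card S2) * \<theta>\<^sup>2"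
    unfolding SS using card_Un_le[of S1 S2] by (intro mult_right_mono) auto
  also have "\<dots> \<le> 15 * ?V ^ (2 * ?d)" using c1 c2 by (simp add: algebra_simps)
  finally show "card S \<le> 15 * ?V ^ (2 * ?d) / \<theta>\<^sup>2" using \<theta> by (simp add: pos_le_divide_eq)
qed

text \<open>Averaging \<open>f\<close> over a \<open>q\<close>-random shift is dual to shifting the
  product of \<open>p\<close> and \<gamma>. The change in \<open>p\<close> costs the shift defect,
  the change in \<gamma> at most its argument. Hence the densities at the finer scale still carry
  the large coefficient.\<close>

lemma local_coefficient_conv:
  fixes f p q :: "'a::{ab_group_add,finite} \<Rightarrow> real"
  assumes p: "sym_prob p" and q: "sym_prob q" and f: "range f \<subseteq> {0..1}" and ch: "character \<gamma>"
  shows "cmod ((\<Sum>n\<in>UNIV. complex_of_real (conv f q (x + n) * p n) * \<gamma> n)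
      - (\<Sum>n\<in>UNIV. complex_of_real (f (x + n) * p n) * \<gamma> n))
    \<le> shift_defect p q + (\<Sum>y\<in>UNIV. q y * \<bar>Arg (\<gamma> y)\<bar>)"
proof -
  have f: "0 \<le> f y" "f y \<le> 1" for y using f by (auto simp: image_subset_iff)
  have "(\<Sum>n\<in>UNIV. complex_of_real (conv f q (x + n) * p n) * \<gamma> n) =
    (\<Sum>n\<in>UNIV. \<Sum>y\<in>UNIV. complex_of_real (q y) * (complex_of_real (f (x + n - y) * p n) * \<gamma> n))"
    unfolding conv_commute by (simp add: sum_distrib_right sum_distrib_left mult_ac)
  also have "\<dots> = (\<Sum>y\<in>UNIV. complex_of_real (q y) * (\<Sum>n\<in>UNIV. complex_of_real (f (x + n - y) * p n) * \<gamma> n))"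
    by (subst sum.swap) (simp only: sum_distrib_left)
  also have "\<dots> = (\<Sum>y\<in>UNIV. complex_of_real (q y) * (\<Sum>n\<in>UNIV. complex_of_real (f (x + n) * p (n + y)) * \<gamma> (n + y)))"
  proof (rule sum.cong[OF refl])
    fix y
    show "complex_of_real (q y) * (\<Sum>n\<in>UNIV. complex_of_real (f (x + n - y) * p n) * \<gamma> n) =
      complex_of_real (q y) * (\<Sum>n\<in>UNIV. complex_of_real (f (x + n) * p (n + y)) * \<gamma> (n + y))"
      using sum_group_add_shift(1)[of "\<lambda>n. complex_of_real (f (x + n - y) * p n) * \<gamma> n" y]
      by (simp add: algebra_simps)
  qed
  finally have 1: "(\<Sum>n\<in>UNIV. complex_of_real (conv f q (x + n) * p n) * \<gamma> n) = \<dots>" .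
  have 2: "(\<Sum>n\<in>UNIV. complex_of_real (f (x + n) * p n) * \<gamma> n) =
    (\<Sum>y\<in>UNIV. complex_of_real (q y) * (\<Sum>n\<in>UNIV. complex_of_real (f (x + n) * p n) * \<gamma> n))"
  proof -
    have "(\<Sum>y\<in>UNIV. complex_of_real (q y)) = 1"
      using sym_probD(3)[OF q] by (metis of_real_1 of_real_sum)
    then show ?thesis by (simp only: sum_distrib_right[symmetric] mult_1)
  qed
  have eq: "(\<Sum>n\<in>UNIV. complex_of_real (conv f q (x + n) * p n) * \<gamma> n)
      - (\<Sum>n\<in>UNIV. complex_of_real (f (x + n) * p n) * \<gamma> n) =
    (\<Sum>y\<in>UNIV. complex_of_real (q y) * (\<Sum>n\<in>UNIV. complex_of_real (f (x + n) * p (n + y)) * \<gamma> (n + y)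
        - complex_of_real (f (x + n) * p n) * \<gamma> n))"
    by (subst 1, subst 2) (simp only: sum_subtractf right_diff_distrib)
  have "cmod ((\<Sum>n\<in>UNIV. complex_of_real (conv f q (x + n) * p n) * \<gamma> n)
      - (\<Sum>n\<in>UNIV. complex_of_real (f (x + n) * p n) * \<gamma> n))
    \<le> (\<Sum>y\<in>UNIV. q y * ((\<Sum>n\<in>UNIV. \<bar>p (n + y) - p n\<bar>) + \<bar>Arg (\<gamma> y)\<bar>))"
    unfolding eq
  proof (rule sum_norm_le)
    fix y
    have "cmod (\<Sum>n\<in>UNIV. complex_of_real (f (x + n) * p (n + y)) * \<gamma> (n + y) - complex_of_real (f (x + n) * p n) * \<gamma> n)
      \<le> (\<Sum>n\<in>UNIV. \<bar>p (n + y) - p n\<bar> + p n * \<bar>Arg (\<gamma> y)\<bar>)"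
    proof (rule sum_norm_le)
      fix n
      have "complex_of_real (f (x + n) * p (n + y)) * \<gamma> (n + y) - complex_of_real (f (x + n) * p n) * \<gamma> n
        = complex_of_real (f (x + n)) * \<gamma> n * (complex_of_real (p (n + y) - p n) * \<gamma> y + complex_of_real (p n) * (\<gamma> y - 1))"
        unfolding character_add[OF ch] by (simp add: algebra_simps)
      then have "cmod (complex_of_real (f (x + n) * p (n + y)) * \<gamma> (n + y) - complex_of_real (f (x + n) * p n) * \<gamma> n)
        = f (x + n) * cmod (complex_of_real (p (n + y) - p n) * \<gamma> y + complex_of_real (p n) * (\<gamma> y - 1))"
        using f by (simp add: norm_mult character_norm[OF ch])
      also have "\<dots> \<le> 1 * (cmod (complex_of_real (p (n + y) - p n) * \<gamma> y) + cmod (complex_of_real (p n) * (\<gamma> y - 1)))"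
        by (intro mult_mono f norm_triangle_ineq) auto
      also have "\<dots> = \<bar>p (n + y) - p n\<bar> + p n * cmod (\<gamma> y - 1)"
        using sym_probD(1)[OF p] by (simp add: norm_mult character_norm[OF ch] del: of_real_diff)
      also have "\<dots> \<le> \<bar>p (n + y) - p n\<bar> + p n * \<bar>Arg (\<gamma> y)\<bar>"
        by (intro add_left_mono mult_left_mono cmod_character_minus_one_le ch sym_probD(1)[OF p])
      finally show "cmod (complex_of_real (f (x + n) * p (n + y)) * \<gamma> (n + y) - complex_of_real (f (x + n) * p n) * \<gamma> n)
        \<le> \<bar>p (n + y) - p n\<bar> + p n * \<bar>Arg (\<gamma> y)\<bar>" .
    qed
    also have "\<dots> = (\<Sum>n\<in>UNIV. \<bar>p (n + y) - p n\<bar>) + \<bar>Arg (\<gamma> y)\<bar>"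
      by (simp only: sum.distrib sum_distrib_right[symmetric] sym_probD(3)[OF p] mult_1)
    finally show "cmod (complex_of_real (q y) * (\<Sum>n\<in>UNIV. complex_of_real (f (x + n) * p (n + y)) * \<gamma> (n + y)
        - complex_of_real (f (x + n) * p n) * \<gamma> n))
      \<le> q y * ((\<Sum>n\<in>UNIV. \<bar>p (n + y) - p n\<bar>) + \<bar>Arg (\<gamma> y)\<bar>)"
      using sym_probD(1)[OF q, of y] by (simp add: norm_mult mult_left_mono)
  qed
  also have "\<dots> = shift_defect p q + (\<Sum>y\<in>UNIV. q y * \<bar>Arg (\<gamma> y)\<bar>)"
    unfolding shift_defect_def by (simp add: distrib_left sum.distrib)
  finally show ?thesis .
qed

text \<open>Cauchy-Schwarz for the probability \<open>p\<close>, obtained from the nonnegative mean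
  of (|g| - e)^2.\<close>

lemma sum_square_ge_of_large_coefficient:
  fixes g p :: "'a::{ab_group_add,finite} \<Rightarrow> real"
  assumes p: "sym_prob p" and ch: "character \<gamma>" and e: "0 \<le> e"
    and large: "e \<le> cmod (\<Sum>n\<in>UNIV. complex_of_real (g n * p n) * \<gamma> n)"
  shows "e\<^sup>2 \<le> (\<Sum>n\<in>UNIV. (g n)\<^sup>2 * p n)"
proof -
  have "cmod (\<Sum>n\<in>UNIV. complex_of_real (g n * p n) * \<gamma> n) \<le> (\<Sum>n\<in>UNIV. \<bar>g n\<bar> * p n)"
    using sym_probD(1)[OF p] by (intro sum_norm_le) (simp add: norm_mult character_norm[OF ch])
  then have m: "e \<le> (\<Sum>n\<in>UNIV. \<bar>g n\<bar> * p n)" using large by linarith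
  have "0 \<le> (\<Sum>n\<in>UNIV. (\<bar>g n\<bar> - e)\<^sup>2 * p n)"
    by (intro sum_nonneg mult_nonneg_nonneg sym_probD(1)[OF p]) auto
  also have "\<dots> = (\<Sum>n\<in>UNIV. (g n)\<^sup>2 * p n) - 2 * e * (\<Sum>n\<in>UNIV. \<bar>g n\<bar> * p n) + e\<^sup>2 * (\<Sum>n\<in>UNIV. p n)"
    unfolding sum_distrib_left sum.distrib[symmetric] sum_subtractf[symmetric]
    by (intro sum.cong refl) (simp add: power2_diff algebra_simps)
  also have "\<dots> \<le> (\<Sum>n\<in>UNIV. (g n)\<^sup>2 * p n) - 2 * e * e + e\<^sup>2"
    using m e by (simp add: sym_probD(3)[OF p] mult_left_mono)
  finally show ?thesis by (simp add: power2_eq_square)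
qed

section \<open>The energy increment\<close>

lemma cube_le_two_power: "10 \<le> n \<Longrightarrow> n ^ 3 \<le> 2 ^ n" for n :: nat
proof (induction n rule: nat_induct_at_least)
  case base show ?case by simp
next
  case (Suc n)
  have "10 * n ^ 2 \<le> n ^ 3" using Suc.hyps by (simp add: power2_eq_square power3_eq_cube)
  moreover have "10 * n \<le> n ^ 2" using Suc.hyps by (simp add: power2_eq_square)
  ultimately have "3 * n ^ 2 + 3 * n + 1 \<le> n ^ 3" using Suc.hyps by linarith
  moreover have "Suc n ^ 3 = n ^ 3 + 3 * n ^ 2 + 3 * n + 1"
    by (simp add: power2_eq_square power3_eq_cube algebra_simps)
  ultimately show ?case using Suc.IH by simp
qed

text \<open>T^(30T + 22) bounds every quantity produced by one refinement; its logarithm is at most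
  31 T^2 \<le> T^3 \<le> 2^T.\<close>

lemma self_power_le_tower_step:
  fixes T :: nat
  assumes "2 ^ 40 \<le> T" shows "T ^ (30 * T + 22) \<le> 2 ^ 2 ^ T"
proof -
  have T: "31 \<le> T" "10 \<le> T" "22 \<le> T" using assms by auto
  have "T ^ (30 * T + 22) \<le> (2 ^ T) ^ (30 * T + 22)"
    by (rule power_mono[OF less_imp_le[OF less_exp]]) simp
  also have "\<dots> = 2 ^ (T * (30 * T + 22))" by (simp add: power_mult)
  also have "\<dots> \<le> 2 ^ 2 ^ T"
  proof (rule power_increasing)
    have "T * (30 * T + 22) \<le> T * (31 * T)" using T by (intro mult_left_mono) auto
    also have "\<dots> \<le> T ^ 3" using T by (simp add: power3_eq_cube)
    also have "\<dots> \<le> 2 ^ T" using T by (intro cube_le_two_power)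
    finally show "T * (30 * T + 22) \<le> 2 ^ T" .
  qed simp
  finally show ?thesis .
qed

lemma less_tower: "h < tower h"
proof (induction h)
  case (Suc h)
  have "tower h < 2 ^ tower h" by (rule less_exp)
  with Suc have "Suc h < 2 ^ tower h" by linarith
  then show ?case by simp
qed simp

lemma tower_mono: "m \<le> n \<Longrightarrow> tower m \<le> tower n"
  by (rule lift_Suc_mono_le[of tower]) (auto intro: less_imp_le less_exp)

text \<open>A single number bounds both |R| and 1/\<eta>, so a whole step is recorded as T going to
  \<open>2 ^ 2 ^ T\<close>.\<close>

definition admissible :: "nat \<Rightarrow> ('a::{ab_group_add,finite} \<Rightarrow> complex) set \<Rightarrow> real \<Rightarrow> bool" where
  "admissible T R \<eta> \<longleftrightarrow> R \<subseteq> {\<gamma>. character \<gamma>} \<and> finite R \<and> card R \<le> T \<and> 0 < \<eta> \<and> \<eta> \<le> 1 \<and> 1 / \<eta> \<le> T"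

lemma admissible_mono: "admissible T R \<eta> \<Longrightarrow> T \<le> T' \<Longrightarrow> admissible T' R \<eta>"
  unfolding admissible_def by (meson of_nat_mono order_trans)

definition energy :: "nat \<Rightarrow> (nat \<Rightarrow> 'a::{ab_group_add,finite} set) \<Rightarrow> ('a \<Rightarrow> complex) set \<Rightarrow> real \<Rightarrow> real" where
  "energy k A R \<eta> = (\<Sum>j\<in>{1..k}. \<Sum>x\<in>UNIV. (conv (indicator (A j)) (psi_fn R \<eta>) x)\<^sup>2)"

lemma range_indicator: "range (indicat_real A) \<subseteq> {0..1}"
  by (auto simp: indicator_def)

lemma energy_le:
  fixes A :: "nat \<Rightarrow> 'a::{ab_group_add,finite} set"
  assumes "finite R" "R \<subseteq> {\<gamma>. character \<gamma>}" "\<eta> > 0"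
  shows "energy k A R \<eta> \<le> k * real CARD('a)"
proof -
  have "energy k A R \<eta> \<le> (\<Sum>j\<in>{1..k}. \<Sum>x\<in>(UNIV::'a set). 1)"
    unfolding energy_def
    by (intro sum_mono power_le_one conv_in_unit_interval range_indicator sym_prob_psi assms)
  then show ?thesis by simp
qed

text \<open>The last estimate is the bound on the shift defect between the two scales of a pair; for
  R empty its left side is 0 and the scale is 1.\<close>

lemma eta2_bounds:
  fixes R :: "('a::{ab_group_add,finite} \<Rightarrow> complex) set" and \<epsilon> \<delta> \<eta> :: real and k T :: nat
  assumes k: "k > 0" and e: "0 < \<epsilon>" "\<epsilon> \<le> 1" and R: "admissible T R \<eta>"
    and T: "2 ^ 40 \<le> T" "k \<le> T" "1 / \<epsilon> \<le> T"
  defines "\<delta> \<equiv> eta2 k \<epsilon> R \<eta>"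
  shows "0 < \<delta>" "\<delta> \<le> 1" "1 / \<delta> \<le> real T ^ 13" "16 * card R * \<delta> / \<eta> \<le> \<epsilon> ^ 3 / (2 ^ 8 * k)"
proof -
  have r: "card R \<le> T" "0 < \<eta>" "\<eta> \<le> 1" "1 / \<eta> \<le> T" using R by (auto simp: admissible_def)
  have T1: "1 \<le> real T" "2 ^ 40 \<le> real T" using T(1) by (auto dest: of_nat_mono[where 'a = real])
  have "0 < \<delta> \<and> \<delta> \<le> 1 \<and> 1 / \<delta> \<le> real T ^ 13 \<and> 16 * card R * \<delta> / \<eta> \<le> \<epsilon> ^ 3 / (2 ^ 8 * k)"
  proof (cases "card R = 0")
    case True
    then show ?thesis using T1 e k by (simp add: \<delta>_def eta2_def)
  next
    case False
    let ?d = "real (card R)"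
    have d: "1 \<le> ?d" using False by simp
    have k1: "1 \<le> real k" "1 \<le> real k ^ 4" "1 \<le> real k ^ 3" using k by (auto intro: one_le_power)
    have eq: "\<delta> = \<epsilon> ^ 6 * \<eta> / (2 ^ 40 * ?d * real k ^ 4)"
      using False by (simp add: \<delta>_def eta2_def powr_minus powr_realpow divide_simps)
    have pos: "0 < \<delta>" unfolding eq using d k1 e r by simp
    have "\<epsilon> ^ 6 * \<eta> \<le> 1 * 1" using e r by (intro mult_mono power_le_one) auto
    also have "\<dots> \<le> (1 * 1) * 1" by simp
    also have "\<dots> \<le> 2 ^ 40 * ?d * real k ^ 4" using d k1 by (intro mult_mono) auto
    finally have "\<delta> \<le> 1" unfolding eq using d k1 by (simp add: divide_le_eq)
    moreover have "1 / \<delta> \<le> real T ^ 13"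
    proof -
      \<comment> \<open>The exponent 13 is 1 + 1 + 4 + 6 + 1, one summand for each factor.\<close>
      have "1 / \<delta> = 2 ^ 40 * ?d * real k ^ 4 * (1 / \<epsilon>) ^ 6 * (1 / \<eta>)"
        unfolding eq using e r by (simp add: divide_simps)
      also have "\<dots> \<le> real T * real T * real T ^ 4 * real T ^ 6 * real T"
        using T T1 r e by (intro mult_mono power_mono) auto
      also have "\<dots> = real T ^ 13" by (simp add: power_numeral_reduce)
      finally show ?thesis .
    qed
    moreover have "16 * ?d * \<delta> / \<eta> \<le> \<epsilon> ^ 3 / (2 ^ 8 * k)"
    proof -
      have "16 * ?d * \<delta> / \<eta> = \<epsilon> ^ 3 * \<epsilon> ^ 3 / (2 ^ 36 * (k * real k ^ 3))"
        unfolding eq using d k1 r by (simp add: field_simps power_numeral_reduce)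
      also have "\<dots> \<le> \<epsilon> ^ 3 * 1 / (2 ^ 8 * (real k * 1))"
      proof (rule frac_le)
        show "\<epsilon> ^ 3 * \<epsilon> ^ 3 \<le> \<epsilon> ^ 3 * 1" using e by (intro mult_left_mono power_le_one) auto
        have "(2::real) ^ 8 \<le> 2 ^ 36" by simp
        moreover have "real k * 1 \<le> k * real k ^ 3" using k1 by (intro mult_left_mono) auto
        ultimately show "(2::real) ^ 8 * (real k * 1) \<le> 2 ^ 36 * (k * real k ^ 3)" by (rule mult_mono) auto
      qed (use e k in auto)
      finally show ?thesis by simp
    qed
    ultimately show ?thesis using pos by simp
  qed
  then show "0 < \<delta>" "\<delta> \<le> 1" "1 / \<delta> \<le> real T ^ 13" "16 * card R * \<delta> / \<eta> \<le> \<epsilon> ^ 3 / (2 ^ 8 * k)" by auto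
qed

text \<open>With \<theta> = \<epsilon>/2 the base of the count is at most T^15, raised to 2|R| \<le>
  2T; the prefactor 60 / \<epsilon>^2 costs T^3.\<close>

lemma card_large_spec_le_power:
  fixes R :: "('a::{ab_group_add,finite} \<Rightarrow> complex) set" and f :: "'a \<Rightarrow> real"
  assumes R: "finite R" "R \<subseteq> {\<gamma>. character \<gamma>}" "card R \<le> T" and e: "0 < \<epsilon>" "\<epsilon> \<le> 1"
    and T: "2 ^ 40 \<le> T" "1 / \<epsilon> \<le> T" and \<delta>: "0 < \<delta>" "1 / \<delta> \<le> real T ^ 13" and f: "range f \<subseteq> {0..1}"
  shows "finite (large_spec (\<epsilon> / 2) f (psi_fn R \<delta>))" "card (large_spec (\<epsilon> / 2) f (psi_fn R \<delta>)) \<le> T ^ (30 * T + 3)"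
proof -
  let ?S = "large_spec (\<epsilon> / 2) f (psi_fn R \<delta>)" and ?V = "4 / (\<epsilon> / 2 * \<delta>) + 2"
  have T1: "1 \<le> real T" "2 ^ 40 \<le> real T" using T(1) by (auto dest: of_nat_mono[where 'a = real])
  have e2: "0 < \<epsilon> / 2" "\<epsilon> / 2 \<le> 1" using e by auto
  show "finite ?S" by (rule card_large_spec_le(1)[OF R(1,2) \<delta>(1) e2 f])
  have "?V = 8 * ((1 / \<epsilon>) * (1 / \<delta>)) + 2" by simp
  also have "\<dots> \<le> 8 * (real T * real T ^ 13) + 2 * real T ^ 14"
    using T T1 \<delta> e by (intro add_mono mult_left_mono mult_mono) auto
  also have "\<dots> = 10 * real T ^ 14" by (simp add: power_numeral_reduce)
  also have "\<dots> \<le> real T * real T ^ 14" using T1 by (intro mult_right_mono) auto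
  also have "\<dots> = real T ^ 15" by (simp add: power_numeral_reduce)
  finally have V: "?V \<le> real T ^ 15" .
  have "real (card ?S) \<le> 15 * ?V ^ (2 * card R) / (\<epsilon> / 2)\<^sup>2"
    by (rule card_large_spec_le(2)[OF R(1,2) \<delta>(1) e2 f])
  also have "\<dots> = 60 * (1 / \<epsilon>)\<^sup>2 * ?V ^ (2 * card R)" by (simp add: power2_eq_square)
  also have "\<dots> \<le> real T * (real T)\<^sup>2 * (real T ^ 15) ^ (2 * card R)"
    using T T1 \<delta> e V by (intro mult_mono power_mono) auto
  also have "\<dots> = real T ^ (3 + 15 * (2 * card R))"
    by (simp only: power_add power_mult) (simp add: power_numeral_reduce)
  also have "\<dots> \<le> real T ^ (30 * T + 3)" using R(3) T1 by (intro power_increasing) auto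
  finally have "real (card ?S) \<le> real (T ^ (30 * T + 3))" by simp
  then show "card ?S \<le> T ^ (30 * T + 3)" by (simp only: of_nat_le_iff)
qed

text \<open>Only index i gains g while every index may lose s, so s must be small compared with
  g/k.\<close>

lemma sum_gain:
  fixes E E' :: "nat \<Rightarrow> real"
  assumes "\<And>j. j \<in> {1..k} \<Longrightarrow> E j \<le> E' j + s" and "i \<in> {1..k}" "E i + g \<le> E' i + s"
  shows "(\<Sum>j\<in>{1..k}. E j) + g \<le> (\<Sum>j\<in>{1..k}. E' j) + k * s"
proof -
  have "(\<Sum>j\<in>{1..k}. E j) + g = (\<Sum>j\<in>{1..k}. E j + (if j = i then g else 0))"
    using assms(2) by (simp add: sum.distrib)
  also have "\<dots> \<le> (\<Sum>j\<in>{1..k}. E' j + s)" using assms by (intro sum_mono) auto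
  finally show ?thesis by (simp add: sum.distrib)
qed

text \<open>The constant c cancels from the comparison. Of the 80, 16 is the shift defect and 64 the
  mean argument: 2 pi \<le> 8 times the mean norm constant 8, with \<delta> \<le> 1 allowing the
  division by \<delta>.\<close>

lemma local_coefficient_psi:
  fixes R R' :: "('a::{ab_group_add,finite} \<Rightarrow> complex) set" and f :: "'a \<Rightarrow> real" and \<delta> \<eta>' :: real
  assumes R': "finite R'" "R' \<subseteq> {\<gamma>. character \<gamma>}" "R \<subseteq> R'" and \<gamma>: "\<gamma> \<in> R'"
    and pos: "0 < \<delta>" "\<delta> \<le> 1" "0 < \<eta>'" and f: "range f \<subseteq> {0..1}"
  shows "cmod (\<Sum>n\<in>UNIV. complex_of_real ((f (x + n) - c) * psi_fn R \<delta> n) * \<gamma> n)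
    \<le> cmod (\<Sum>n\<in>UNIV. complex_of_real ((conv f (psi_fn R' \<eta>') (x + n) - c) * psi_fn R \<delta> n) * \<gamma> n)
       + 80 * (card R' * \<eta>' / \<delta>)"
proof -
  let ?p = "psi_fn R \<delta>" and ?q = "psi_fn R' \<eta>'"
  have R: "finite R" "R \<subseteq> {\<gamma>. character \<gamma>}" using R' by (auto intro: finite_subset)
  have p: "sym_prob ?p" by (rule sym_prob_psi[OF R pos(1)])
  have q: "sym_prob ?q" by (rule sym_prob_psi[OF R'(1,2) pos(3)])
  have ch: "character \<gamma>" using \<gamma> R' by auto
  let ?F = "\<Sum>n\<in>UNIV. complex_of_real (f (x + n) * ?p n) * \<gamma> n"
  let ?B = "\<Sum>n\<in>UNIV. complex_of_real (conv f ?q (x + n) * ?p n) * \<gamma> n"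
  let ?Q = "\<Sum>n\<in>UNIV. complex_of_real (c * ?p n) * \<gamma> n"
  define D where "D = card R' * \<eta>' / \<delta>"
  have "(\<Sum>y\<in>UNIV. ?q y * \<bar>Arg (\<gamma> y)\<bar>) \<le> (\<Sum>y\<in>UNIV. ?q y * (2 * pi * bnorm R' y))"
    by (intro sum_mono mult_left_mono Arg_le_bnorm R' \<gamma> sym_probD(1)[OF q])
  also have "\<dots> = 2 * pi * (\<Sum>y\<in>UNIV. ?q y * bnorm R' y)"
    unfolding sum_distrib_left by (intro sum.cong refl) simp
  also have "\<dots> \<le> 2 * pi * (8 * card R' * \<eta>')"
    by (intro mult_left_mono psi_fn_mean_bnorm R' pos) auto
  also have "\<dots> \<le> 8 * (8 * card R' * \<eta>')"
    using pi_less_4 pos by (intro mult_right_mono) auto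
  also have "\<dots> \<le> 8 * (8 * card R' * \<eta>') / \<delta>"
    using pos by (simp add: pos_le_divide_eq mult_left_le)
  finally have "(\<Sum>y\<in>UNIV. ?q y * \<bar>Arg (\<gamma> y)\<bar>) \<le> 64 * D" by (simp add: D_def)
  moreover have "shift_defect ?p ?q \<le> 16 * D"
    using shift_defect_psi_le[OF R' pos(1,3)] by (simp add: D_def mult.assoc)
  ultimately have "cmod (?B - ?F) \<le> 80 * D"
    using local_coefficient_conv[OF p q f ch, of x] by linarith
  moreover have "(\<Sum>n\<in>UNIV. complex_of_real ((g (x + n) - c) * ?p n) * \<gamma> n) =
      (\<Sum>n\<in>UNIV. complex_of_real (g (x + n) * ?p n) * \<gamma> n) - ?Q" for g
    unfolding sum_subtractf[symmetric] by (intro sum.cong refl) (simp add: algebra_simps)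
  moreover have "cmod (?F - ?Q) \<le> cmod (?B - ?Q) + cmod (?B - ?F)"
    using norm_triangle_ineq4[of "?B - ?Q" "?B - ?F"] by simp
  ultimately show ?thesis unfolding D_def by simp
qed

lemma regularity_step:
  fixes A :: "nat \<Rightarrow> 'a::{ab_group_add,finite} set"
  assumes k: "k > 0" and e: "0 < \<epsilon>" "\<epsilon> \<le> 1" and R: "admissible T R \<eta>"
    and T: "2 ^ 40 \<le> T" "k \<le> T" "1 / \<epsilon> \<le> T"
    and i: "i \<in> {1..k}" and irreg: "\<not> regular_pair k \<epsilon> (A i) R \<eta>"
  shows "\<exists>R' \<eta>'. admissible (2 ^ 2 ^ T) R' \<eta>' \<and> energy k A R \<eta> + \<epsilon> ^ 3 / 16 * CARD('a) \<le> energy k A R' \<eta>'"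
proof -
  let ?N = "real CARD('a)"
  define \<delta> where "\<delta> = eta2 k \<epsilon> R \<eta>"
  let ?E = "\<lambda>R \<eta> j. \<Sum>x\<in>UNIV. (conv (indicator (A j)) (psi_fn R \<eta>) x)\<^sup>2"
  let ?f = "indicat_real (A i)" and ?p1 = "psi_fn R \<eta>" and ?p2 = "psi_fn R \<delta>"
  let ?a1 = "conv ?f ?p1" and ?a2 = "conv ?f ?p2"
  have r: "finite R" "R \<subseteq> {\<gamma>. character \<gamma>}" "card R \<le> T" "0 < \<eta>" "\<eta> \<le> 1" "1 / \<eta> \<le> T"
    using R by (auto simp: admissible_def)
  note \<delta> = eta2_bounds[OF k e R T, folded \<delta>_def]
  have T1: "1 \<le> real T" "2 ^ 40 \<le> real T" using T(1) by (auto dest: of_nat_mono[where 'a = real])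
  have p1: "sym_prob ?p1" by (rule sym_prob_psi[OF r(1,2,4)])
  have p2: "sym_prob ?p2" by (rule sym_prob_psi[OF r(1,2) \<delta>(1)])
  \<comment> \<open>Energy that one set may lose per change of kernel; over k sets this is
    \<epsilon>^3 N / 128. Case (i) gains \<epsilon>^3 N / 2 and pays once, case (ii) gains
    \<epsilon>^3 N / 8 and pays twice, so \<epsilon>^3 N / 16 remains in both.\<close>
  define s where "s = \<epsilon> ^ 3 / (2 ^ 7 * k) * ?N"
  have s: "k * s = \<epsilon> ^ 3 / 2 ^ 7 * ?N" using k by (simp add: s_def)
  have e3: "0 < \<epsilon> ^ 3 * ?N" using e by simp
  have d12: "2 * shift_defect ?p1 ?p2 * ?N \<le> s"
  proof -
    have "shift_defect ?p1 ?p2 \<le> \<epsilon> ^ 3 / (2 ^ 8 * k)"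
      using shift_defect_psi_le[OF r(1,2) subset_refl r(4) \<delta>(1)] \<delta>(4) by linarith
    then have "2 * shift_defect ?p1 ?p2 * ?N \<le> 2 * (\<epsilon> ^ 3 / (2 ^ 8 * k)) * ?N"
      by (intro mult_right_mono mult_left_mono) auto
    then show ?thesis by (simp add: s_def)
  qed
  have E12: "?E R \<eta> j \<le> ?E R \<delta> j + s" for j
    using energy_almost_monotone[OF p1 p2 range_indicator, of "A j"] d12 by linarith
  define X1 where "X1 = {x. \<epsilon>\<^sup>2 < (\<Sum>y\<in>UNIV. (?a2 (x + y) - ?a1 x)\<^sup>2 * ?p1 y)}"
  define X2 where "X2 = {x. \<exists>\<gamma>. character \<gamma> \<and> \<epsilon> < cmod (\<Sum>n\<in>UNIV. complex_of_real ((?f (x + n) - ?a2 x) * ?p2 n) * \<gamma> n)}"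
  have "{x. \<not> regular_value k \<epsilon> (A i) R \<eta> x} \<subseteq> X1 \<union> X2"
    unfolding regular_value_def psi1_def psi2_def Let_def \<delta>_def[symmetric] X1_def X2_def by (auto simp: not_le)
  then have "card {x. \<not> regular_value k \<epsilon> (A i) R \<eta> x} \<le> card X1 + card X2"
    by (meson card_Un_le card_mono finite order_trans)
  moreover have "\<epsilon> * ?N \<le> card {x. \<not> regular_value k \<epsilon> (A i) R \<eta> x}"
    using irreg by (simp add: regular_pair_def)
  ultimately have "\<epsilon> * ?N \<le> real (card X1) + real (card X2)" by linarith
  then consider (i) "\<epsilon> * ?N / 2 \<le> card X1" | (ii) "\<epsilon> * ?N / 2 \<le> card X2" by linarith
  then show ?thesis
  proof cases
    case i
    have "?E R \<eta> i + \<epsilon>\<^sup>2 * card X1 \<le> ?E R \<delta> i + 2 * shift_defect ?p1 ?p2 * ?N"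
      by (rule energy_gain_of_local_variance[OF p1 p2 range_indicator]) (auto simp: X1_def)
    moreover have "\<epsilon>\<^sup>2 * (\<epsilon> * ?N / 2) \<le> \<epsilon>\<^sup>2 * card X1" using i by (intro mult_left_mono) auto
    ultimately have "?E R \<eta> i + \<epsilon> ^ 3 * ?N / 2 \<le> ?E R \<delta> i + s"
      using d12 by (simp add: power2_eq_square power3_eq_cube)
    then have "energy k A R \<eta> + \<epsilon> ^ 3 * ?N / 2 \<le> energy k A R \<delta> + k * s"
      unfolding energy_def by (intro sum_gain[OF E12 assms(8)])
    then have "energy k A R \<eta> + \<epsilon> ^ 3 / 16 * ?N \<le> energy k A R \<delta>" using s e3 by simp
    moreover have "admissible (2 ^ 2 ^ T) R \<delta>"
    proof (rule admissible_mono)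
      have "real T ^ 13 \<le> real T ^ (30 * T + 22)" using T1 by (intro power_increasing) auto
      then have "1 / \<delta> \<le> real T ^ (30 * T + 22)" using \<delta>(3) by linarith
      then show "admissible (T ^ (30 * T + 22)) R \<delta>"
        using r \<delta> self_le_power[of T "30 * T + 22"] T(1) unfolding admissible_def by auto
      show "T ^ (30 * T + 22) \<le> 2 ^ 2 ^ T" by (rule self_power_le_tower_step[OF T(1)])
    qed
    ultimately show ?thesis by blast
  next
    case ii
    define S where "S = large_spec (\<epsilon> / 2) ?f ?p2"
    define R' where "R' = R \<union> S"
    note S = card_large_spec_le_power[OF r(1-3) e T(1,3) \<delta>(1,3) range_indicator, of "A i", folded S_def]
    have a2: "0 \<le> ?a2 x" "?a2 x \<le> 1" for x by (auto intro: conv_in_unit_interval[OF p2 range_indicator])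
    have inS: "\<gamma> \<in> S" if "character \<gamma>" "\<epsilon> < cmod (\<Sum>n\<in>UNIV. complex_of_real ((?f (x + n) - ?a2 x) * ?p2 n) * \<gamma> n)" for x \<gamma>
      unfolding S_def using that a2[of x] by (intro mem_large_specI[where c = "?a2 x" and x = x]) auto
    have r': "finite R'" "R' \<subseteq> {\<gamma>. character \<gamma>}" "R \<subseteq> R'"
      using r S by (auto simp: R'_def S_def large_spec_def)
    \<comment> \<open>A bad point forces a large character, so \<open>R'\<close> is nonempty and its
      size may be a denominator in the new scale.\<close>
    have "0 < real (card X2)" using ii e by (smt (verit) divide_pos_pos mult_pos_pos of_nat_0_less_iff zero_less_card_finite)
    then have "X2 \<noteq> {}" by auto
    then have "S \<noteq> {}" using inS by (auto simp: X2_def)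
    then have d1: "1 \<le> card R'" using r'(1) by (simp add: R'_def Suc_leI card_gt_0_iff)
    have d2: "card R' \<le> T ^ (30 * T + 4)"
    proof -
      have "card R' \<le> T + T ^ (30 * T + 3)"
        unfolding R'_def using card_Un_le[of R S] r(3) S(2) by linarith
      also have "\<dots> \<le> 2 * T ^ (30 * T + 3)" using self_le_power[of T "30 * T + 3"] T(1) by simp
      also have "\<dots> \<le> T * T ^ (30 * T + 3)" using T(1) by (intro mult_right_mono) auto
      also have "\<dots> = T ^ (30 * T + 4)" by (simp add: power_add power_numeral_reduce)
      finally show ?thesis .
    qed
    \<comment> \<open>Makes |R'| \<eta>'/\<delta> equal to \<epsilon>^3 / (2^13 k): 16 times this
      meets the allowed defect, and 80 times this is at most \<epsilon>/2, so half of each large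
      coefficient survives.\<close>
    define \<eta>' where "\<eta>' = \<epsilon> ^ 3 * \<delta> / (2 ^ 13 * k * card R')"
    have e3le: "\<epsilon> ^ 3 \<le> 1" "\<epsilon> ^ 3 \<le> \<epsilon>" using e power_decreasing[of 1 3 \<epsilon>] by (auto intro: power_le_one)
    have k1: "1 \<le> real k" using k by simp
    have pos: "0 < \<eta>'" unfolding \<eta>'_def using e \<delta> k d1 by (intro divide_pos_pos mult_pos_pos) auto
    have ratio: "card R' * \<eta>' / \<delta> = \<epsilon> ^ 3 / (2 ^ 13 * k)"
      unfolding \<eta>'_def using \<delta>(1) d1 k by (simp add: field_simps)
    let ?q = "psi_fn R' \<eta>'"
    have q: "sym_prob ?q" by (rule sym_prob_psi[OF r'(1,2) pos])
    have d23: "2 * shift_defect ?p2 ?q * ?N \<le> s"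
    proof -
      have "shift_defect ?p2 ?q \<le> 16 * (card R' * \<eta>' / \<delta>)"
        using shift_defect_psi_le[OF r' \<delta>(1) pos] by (simp add: mult.assoc)
      also have "\<dots> \<le> \<epsilon> ^ 3 / (2 ^ 8 * k)" unfolding ratio using e k1 by (simp add: field_simps)
      finally have "2 * shift_defect ?p2 ?q * ?N \<le> 2 * (\<epsilon> ^ 3 / (2 ^ 8 * k)) * ?N"
        by (intro mult_right_mono mult_left_mono) auto
      then show ?thesis by (simp add: s_def)
    qed
    have E23: "?E R \<delta> j \<le> ?E R' \<eta>' j + s" for j
      using energy_almost_monotone[OF p2 q range_indicator, of "A j"] d23 by linarith
    have err: "80 * (card R' * \<eta>' / \<delta>) \<le> \<epsilon> / 2"
    proof -
      have "80 * (card R' * \<eta>' / \<delta>) = 80 * (\<epsilon> ^ 3 / (2 ^ 13 * k))" unfolding ratio ..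
      also have "\<dots> \<le> 80 * (\<epsilon> / (2 ^ 13 * 1))"
        using e3le k1 e by (intro mult_left_mono frac_le) auto
      finally show ?thesis using e by simp
    qed
    have var: "(\<epsilon> / 2)\<^sup>2 \<le> (\<Sum>y\<in>UNIV. (conv ?f ?q (x + y) - ?a2 x)\<^sup>2 * ?p2 y)" if "x \<in> X2" for x
    proof -
      obtain \<gamma> where g: "character \<gamma>" "\<epsilon> < cmod (\<Sum>n\<in>UNIV. complex_of_real ((?f (x + n) - ?a2 x) * ?p2 n) * \<gamma> n)"
        using \<open>x \<in> X2\<close> unfolding X2_def by blast
      then have "\<gamma> \<in> R'" using inS by (auto simp: R'_def)
      then have "\<epsilon> / 2 \<le> cmod (\<Sum>n\<in>UNIV. complex_of_real ((conv ?f ?q (x + n) - ?a2 x) * ?p2 n) * \<gamma> n)"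
        using local_coefficient_psi[OF r' _ \<delta>(1,2) pos range_indicator, of \<gamma> "A i" x "?a2 x"] g(2) err by linarith
      then show ?thesis using e by (intro sum_square_ge_of_large_coefficient[OF p2 g(1)]) auto
    qed
    have "?E R \<delta> i + (\<epsilon> / 2)\<^sup>2 * card X2 \<le> ?E R' \<eta>' i + 2 * shift_defect ?p2 ?q * ?N"
      by (rule energy_gain_of_local_variance[OF p2 q range_indicator var])
    moreover have "(\<epsilon> / 2)\<^sup>2 * (\<epsilon> * ?N / 2) \<le> (\<epsilon> / 2)\<^sup>2 * card X2" using ii by (intro mult_left_mono) auto
    ultimately have "?E R \<delta> i + \<epsilon> ^ 3 * ?N / 8 \<le> ?E R' \<eta>' i + s"
      using d23 by (simp add: power2_eq_square power3_eq_cube)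
    then have "energy k A R \<delta> + \<epsilon> ^ 3 * ?N / 8 \<le> energy k A R' \<eta>' + k * s"
      unfolding energy_def by (intro sum_gain[OF E23 assms(8)])
    \<comment> \<open>The gain was measured from the second scale, which may itself lie below the
      energy of the original pair; the two are linked with zero gain.\<close>
    moreover have "energy k A R \<eta> + 0 \<le> energy k A R \<delta> + k * s"
      unfolding energy_def using E12 by (intro sum_gain[OF E12 assms(8)]) simp
    ultimately have "energy k A R \<eta> + \<epsilon> ^ 3 / 16 * ?N \<le> energy k A R' \<eta>'" using s e3 by simp
    moreover have "admissible (2 ^ 2 ^ T) R' \<eta>'"
    proof (rule admissible_mono)
      have "\<epsilon> ^ 3 * \<delta> \<le> 1 * 1" using e3le \<delta>(1,2) by (intro mult_mono) auto
      also have "\<dots> \<le> (1 * 1) * 1" by simp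
      also have "\<dots> \<le> 2 ^ 13 * real k * real (card R')" using k1 d1 by (intro mult_mono) auto
      finally have "\<eta>' \<le> 1" unfolding \<eta>'_def using k d1 by (simp add: divide_le_eq)
      moreover have "1 / \<eta>' \<le> T ^ (30 * T + 22)"
      proof -
        have "1 / \<eta>' = 2 ^ 13 * real k * real (card R') * (1 / \<epsilon>) ^ 3 * (1 / \<delta>)"
          unfolding \<eta>'_def by (simp add: power_divide)
        also have "\<dots> \<le> real T * real T * real T ^ (30 * T + 4) * real T ^ 3 * real T ^ 13"
        proof (intro mult_mono power_mono)
          show "real (card R') \<le> real T ^ (30 * T + 4)" using d2 by (metis of_nat_le_iff of_nat_power)
        qed (use T T1 \<delta> e in auto)
        also have "\<dots> = real T ^ (1 + 1 + (30 * T + 4) + 3 + 13)" by (simp only: power_add power_one_right)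
        finally show ?thesis by (simp add: add.commute)
      qed
      moreover have "card R' \<le> T ^ (30 * T + 22)"
        using T(1) by (intro order_trans[OF d2 power_increasing]) auto
      ultimately show "admissible (T ^ (30 * T + 22)) R' \<eta>'" using r' pos unfolding admissible_def by auto
      show "T ^ (30 * T + 22) \<le> 2 ^ 2 ^ T" by (rule self_power_le_tower_step[OF T(1)])
    qed
    ultimately show ?thesis by blast
  qed
qed

section \<open>Iteration and the final tower height\<close>

text \<open>The disjunction carries the induction: a pair that is already regular is kept while only
  its bound grows, otherwise each round adds a fixed amount of energy.\<close>

lemma regularity_iterate:
  fixes A :: "nat \<Rightarrow> 'a::{ab_group_add,finite} set"
  assumes k: "k > 0" and e: "0 < \<epsilon>" "\<epsilon> \<le> 1"
    and h: "2 ^ 40 \<le> tower h" "k \<le> tower h" "1 / \<epsilon> \<le> tower h"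
  shows "\<exists>R \<eta>. admissible (tower (h + 2 * n)) R \<eta> \<and>
    ((\<forall>i\<in>{1..k}. regular_pair k \<epsilon> (A i) R \<eta>) \<or> n * (\<epsilon> ^ 3 / 16 * CARD('a)) \<le> energy k A R \<eta>)"
proof (induction n)
  case 0
  have "admissible (tower h) ({} :: ('a \<Rightarrow> complex) set) 1" using h(1) by (simp add: admissible_def)
  moreover have "0 \<le> energy k A {} 1" unfolding energy_def by (intro sum_nonneg) auto
  ultimately show ?case by auto
next
  case (Suc n)
  let ?T = "tower (h + 2 * n)"
  from Suc obtain R \<eta> where R: "admissible ?T R \<eta>" and
    alt: "(\<forall>i\<in>{1..k}. regular_pair k \<epsilon> (A i) R \<eta>) \<or> n * (\<epsilon> ^ 3 / 16 * CARD('a)) \<le> energy k A R \<eta>" by blast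
  have T: "2 ^ 40 \<le> ?T" "k \<le> ?T" "1 / \<epsilon> \<le> ?T"
    using h tower_mono[of h "h + 2 * n"] by (auto intro: order_trans)
  have step: "tower (h + 2 * Suc n) = 2 ^ 2 ^ ?T" by simp
  show ?case
  proof (cases "\<forall>i\<in>{1..k}. regular_pair k \<epsilon> (A i) R \<eta>")
    case True
    moreover have "admissible (tower (h + 2 * Suc n)) R \<eta>" by (rule admissible_mono[OF R tower_mono]) simp
    ultimately show ?thesis by blast
  next
    case False
    then obtain i where i: "i \<in> {1..k}" "\<not> regular_pair k \<epsilon> (A i) R \<eta>" by blast
    obtain R' \<eta>' where R': "admissible (2 ^ 2 ^ ?T) R' \<eta>'"
      "energy k A R \<eta> + \<epsilon> ^ 3 / 16 * CARD('a) \<le> energy k A R' \<eta>'"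
      using regularity_step[where A = A, OF k e R T i] by blast
    moreover have "Suc n * (\<epsilon> ^ 3 / 16 * CARD('a)) \<le> energy k A R' \<eta>'"
      using alt False R'(2) by (auto simp: algebra_simps)
    ultimately show ?thesis unfolding step by blast
  qed
qed

theorem theorem5p3:
  fixes k :: nat and \<epsilon> :: real and A :: "nat \<Rightarrow> 'a::{ab_group_add,finite} set"
  assumes "k > 0" and "\<epsilon> > 0"
  shows "\<exists>R \<eta>. R \<subseteq> {\<gamma>. character \<gamma>} \<and> finite R \<and>
            card R \<le> W (2^11 * real k ^ 2 * \<epsilon> powr (-3)) \<and>
            0 < \<eta> \<and> \<eta> \<le> 1 \<and> \<eta> \<ge> 1 / real (W (2^11 * real k ^ 2 * \<epsilon> powr (-3))) \<and>
            (\<forall>i\<in>{1..k}. regular_pair k \<epsilon> (A i) R \<eta>)"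
proof -
  let ?t = "2^11 * real k ^ 2 * \<epsilon> powr (-3)"
  have "\<exists>R \<eta>. admissible (W ?t) R \<eta> \<and> (\<forall>i\<in>{1..k}. regular_pair k \<epsilon> (A i) R \<eta>)"
  proof (cases "\<epsilon> \<le> 1")
    case False
    \<comment> \<open>For \<epsilon> > 1 even N irregular points are fewer than \<epsilon> N, so any
      pair will do.\<close>
    have "regular_pair k \<epsilon> (A i) {} 1" for i
    proof -
      have "real (card {x. \<not> regular_value k \<epsilon> (A i) {} 1 x}) \<le> 1 * real CARD('a)"
        by (simp add: card_mono)
      also have "\<dots> < \<epsilon> * real CARD('a)" using False by (intro mult_strict_right_mono) auto
      finally show ?thesis unfolding regular_pair_def .
    qed
    moreover have "admissible (W ?t) ({} :: ('a \<Rightarrow> complex) set) 1"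
      using less_tower[of "nat \<lceil>?t\<rceil>"] by (simp add: admissible_def W_def)
    ultimately show ?thesis by blast
  next
    case True
    let ?u = "1 / \<epsilon> ^ 3"
    \<comment> \<open>Starting height: a tower exceeds its height, so k and 1/\<epsilon> are covered
      directly, and 41 = 40 + 1 leaves one exponential to reach 2^40.\<close>
    define h where "h = 41 + k + nat \<lceil>1 / \<epsilon>\<rceil>"
    \<comment> \<open>One more than the floor, so that n increments strictly exceed the maximal
      energy k N.\<close>
    define n where "n = nat \<lfloor>16 * k * ?u\<rfloor> + 1"
    have "2 ^ 40 \<le> tower h"
    proof -
      have "(2::nat) ^ 40 \<le> 2 ^ tower (40 + k + nat \<lceil>1 / \<epsilon>\<rceil>)"
        using less_tower[of "40 + k + nat \<lceil>1 / \<epsilon>\<rceil>"] by (intro power_increasing) auto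
      also have "\<dots> = tower h" unfolding h_def by (simp only: tower.simps[symmetric]) (simp add: add.assoc)
      finally show ?thesis .
    qed
    moreover have "k \<le> tower h" using less_tower[of h] by (simp add: h_def)
    moreover have "1 / \<epsilon> \<le> tower h"
    proof -
      have "nat \<lceil>1 / \<epsilon>\<rceil> \<le> tower h" using less_tower[of h] unfolding h_def by linarith
      then show ?thesis by linarith
    qed
    ultimately obtain R \<eta> where R: "admissible (tower (h + 2 * n)) R \<eta>" and
      alt: "(\<forall>i\<in>{1..k}. regular_pair k \<epsilon> (A i) R \<eta>) \<or> n * (\<epsilon> ^ 3 / 16 * CARD('a)) \<le> energy k A R \<eta>"
      using regularity_iterate[where A = A and n = n, OF assms True] by blast
    have "energy k A R \<eta> \<le> k * real CARD('a)"
      using R by (intro energy_le) (auto simp: admissible_def)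
    also have "\<dots> < n * (\<epsilon> ^ 3 / 16 * CARD('a))"
    proof -
      have "16 * k * ?u < n" unfolding n_def using assms by linarith
      then have "k < n * (\<epsilon> ^ 3 / 16)" using assms by (simp add: field_simps)
      then show ?thesis by simp
    qed
    finally have reg: "\<forall>i\<in>{1..k}. regular_pair k \<epsilon> (A i) R \<eta>" using alt by auto
    have "h + 2 * n \<le> nat \<lceil>?t\<rceil>"
    proof -
      have k1: "1 \<le> real k" using assms by simp
      have u1: "1 \<le> ?u" using assms True by (simp add: power_le_one)
      have "\<epsilon> ^ 3 \<le> \<epsilon>" using power_decreasing[of 1 3 \<epsilon>] assms True by simp
      then have eu: "1 / \<epsilon> \<le> ?u" using assms by (intro divide_left_mono) auto
      have kk: "real k \<le> (real k)\<^sup>2" using k1 by (simp add: power2_eq_square)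
      have b1: "(real k)\<^sup>2 \<le> (real k)\<^sup>2 * ?u" using mult_left_mono[OF u1, of "(real k)\<^sup>2"] by simp
      have b2: "?u \<le> (real k)\<^sup>2 * ?u" using mult_right_mono[of 1 "(real k)\<^sup>2" ?u] k1 u1 assms(2) by simp
      have b3: "k * ?u \<le> (real k)\<^sup>2 * ?u" using kk u1 assms(2) by (intro mult_right_mono) auto
      have t: "?t = 2 ^ 11 * ((real k)\<^sup>2 * ?u)" using assms by (simp add: powr_minus powr_realpow divide_inverse)
      have "real (nat \<lceil>1 / \<epsilon>\<rceil>) \<le> 1 / \<epsilon> + 1" using assms by (simp add: of_nat_nat)
      moreover have "0 \<le> 16 * k * ?u" using assms(2) by (intro mult_nonneg_nonneg) auto
      then have "real n \<le> 16 * (k * ?u) + 1" unfolding n_def by (simp add: of_nat_nat)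
      ultimately have "real (h + 2 * n) \<le> 41 + k + (1 / \<epsilon> + 1) + 2 * (16 * (k * ?u) + 1)"
        by (simp add: h_def)
      also have "\<dots> \<le> ?t"
      proof -
        define X Y where "X = (real k)\<^sup>2 * ?u" and "Y = k * ?u"
        \<comment> \<open>The height is at most 44 + k + 1/\<epsilon> + 32 Y, hence at most 78 X,
          well below 2^11 X.\<close>
        have "k \<le> X" "1 / \<epsilon> \<le> X" "Y \<le> X" "1 \<le> X"
          using kk b1 b2 b3 eu u1 unfolding X_def Y_def by linarith+
        then show ?thesis unfolding t X_def[symmetric] Y_def[symmetric] by simp
      qed
      finally show ?thesis by linarith
    qed
    then have "admissible (W ?t) R \<eta>" unfolding W_def by (intro admissible_mono[OF R] tower_mono)
    with reg show ?thesis by blast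
  qed
  then obtain R \<eta> where R: "admissible (W ?t) R \<eta>" "\<forall>i\<in>{1..k}. regular_pair k \<epsilon> (A i) R \<eta>" by blast
  then have "0 < \<eta>" "1 / \<eta> \<le> W ?t" by (auto simp: admissible_def)
  then have "1 / real (W ?t) \<le> \<eta>" by (smt (verit) divide_le_eq divide_pos_pos mult.commute zero_less_one)
  with R show ?thesis unfolding admissible_def by (intro exI[of _ R] exI[of _ \<eta>]) blast
qed

end
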